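(* Let $0<\varepsilon<\frac12$ be a real number. Then there exists a radical ideal of points $I_\varepsilon$ in $\mathbb{K}[\mathbb{P}^2]$ such that $\rho(I_\varepsilon)\in[2-\varepsilon,2)$.
   Context: $\mathbb{K}$ is an algebraically closed field and $R=\mathbb{K}[\mathbb{P}^2]=\mathbb{K}[x_0,x_1,x_2]$ is the coordinate ring of the projective plane over $\mathbb{K}$. A radical ideal of points is the homogeneous ideal generated by all forms vanishing at every point of some finite set of points $p_1,\dots,p_n\in\mathbb{P}^2$. For a positive integer $m$, the symbolic power of such an ideal $I$ is $I^{(m)}=\bigcap_i I(p_i)^m$, where $I(p_i)$ is the ideal of the point $p_i$ (equivalently $I^{(m)}=R\cap I^mR_U$ with $U=R-\bigcup_{P\in\mathrm{Ass}(I)}P$). $I^r$ is the ordinary power. The resurgence is $\rho(I)=\sup\{\frac{m}{r}\mid m,r\text{ positive integers},\ I^{(m)}\nsubseteq I^r\}$. *)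

theory Defs
  imports
    "HOL-Library.Poly_Mapping"
    "HOL-Library.Extended_Real"
    "HOL-Library.Numeral_Type"
    "HOL-Computational_Algebra.Polynomial"
    "HOL-Analysis.Finite_Cartesian_Product"
begin

text \<open>
  The polynomial ring in the three variables indexed by the numeral type \<^typ>\<open>3\<close>, whose elements
  are \<open>0\<close>, \<open>1\<close>, \<open>2\<close>: a polynomial maps exponent vectors to coefficients, and multiplication is the
  convolution product of \<^type>\<open>poly_mapping\<close>.
\<close>

type_synonym 'k plane_ring = "(3 \<Rightarrow>\<^sub>0 nat) \<Rightarrow>\<^sub>0 'k"

definition monom_eval :: "(3 \<Rightarrow>\<^sub>0 nat) \<Rightarrow> 'k::comm_semiring_1 ^ 3 \<Rightarrow> 'k" where
  "monom_eval e v = (\<Prod>i\<in>UNIV. v $ i ^ Poly_Mapping.lookup e i)"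

definition eval :: "'k::comm_semiring_1 plane_ring \<Rightarrow> 'k ^ 3 \<Rightarrow> 'k" where
  "eval f v = (\<Sum>e\<in>Poly_Mapping.keys f. Poly_Mapping.lookup f e * monom_eval e v)"

text \<open>The zero polynomial is a form of every degree.\<close>

definition is_form :: "'k::zero plane_ring \<Rightarrow> bool" where
  "is_form f \<longleftrightarrow> (\<exists>d. \<forall>e\<in>Poly_Mapping.keys f. (\<Sum>i\<in>UNIV. Poly_Mapping.lookup e i) = d)"


text \<open>
  Points of the projective plane are classes of nonzero vectors modulo nonzero scalars.
\<close>

definition proj_rel :: "('k::field ^ 3) rel" where
  "proj_rel = {(v, w). v \<noteq> 0 \<and> (\<exists>c. c \<noteq> 0 \<and> w = c *s v)}"

definition proj_plane :: "('k::field ^ 3) set set" where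
  "proj_plane = {v. v \<noteq> 0} // proj_rel"

definition vanishes_at :: "'k::field plane_ring \<Rightarrow> ('k ^ 3) set \<Rightarrow> bool" where
  "vanishes_at f P \<longleftrightarrow> (\<forall>v\<in>P. eval f v = 0)"


text \<open>
  Ideals are submodules of the ring regarded as a module over itself; in particular \<open>ideal.span S\<close>
  is the ideal generated by \<open>S\<close>.
\<close>

global_interpretation ideal: module "(*) :: 'a::comm_ring_1 \<Rightarrow> 'a \<Rightarrow> 'a"
  by unfold_locales (simp_all add: algebra_simps)

primrec ideal_power :: "'a::comm_ring_1 set \<Rightarrow> nat \<Rightarrow> 'a set" where
  "ideal_power I 0 = UNIV"
| "ideal_power I (Suc n) = ideal.span {a * b | a b. a \<in> I \<and> b \<in> ideal_power I n}"

definition vanishing_ideal :: "('k::field ^ 3) set set \<Rightarrow> 'k plane_ring set" where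
  "vanishing_ideal Z = ideal.span {f. is_form f \<and> (\<forall>P\<in>Z. vanishes_at f P)}"

definition radical_ideal_of_points :: "'k::field plane_ring set \<Rightarrow> bool" where
  "radical_ideal_of_points I \<longleftrightarrow>
    (\<exists>Z. finite Z \<and> Z \<noteq> {} \<and> Z \<subseteq> proj_plane \<and> I = vanishing_ideal Z)"

definition zero_locus :: "'k::field plane_ring set \<Rightarrow> ('k ^ 3) set set" where
  "zero_locus I = {P\<in>proj_plane. \<forall>f\<in>I. vanishes_at f P}"

text \<open>
  The definition is meant for radical ideals of points only. If \<open>I\<close> is the ideal of the points
  \<open>p\<^sub>1, \<dots>, p\<^sub>n\<close>, then its zero locus consists of exactly these points, so that this is the
  intersection of the powers of the ideals of the \<open>p\<^sub>i\<close>; see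
  \<open>symbolic_power_vanishing_ideal\<close> below.
\<close>

definition symbolic_power :: "'k::field plane_ring set \<Rightarrow> nat \<Rightarrow> 'k plane_ring set" where
  "symbolic_power I m = (\<Inter>P\<in>zero_locus I. ideal_power (vanishing_ideal {P}) m)"

text \<open>The supremum is taken in the extended reals, where it always exists.\<close>

definition resurgence :: "'k::field plane_ring set \<Rightarrow> ereal" where
  "resurgence I = Sup {ereal (real m / real r) | m r.
     m > 0 \<and> r > 0 \<and> \<not> symbolic_power I m \<subseteq> ideal_power I r}"


subsection \<open>The points are determined by their ideal\<close>

lemma monom_eval_add: "monom_eval (a + b) v = monom_eval a v * monom_eval b v"
  by (simp add: monom_eval_def lookup_add power_add prod.distrib)

lemma monom_eval_0 [simp]: "monom_eval 0 v = 1"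
  by (simp add: monom_eval_def)

lemma monom_eval_single: "monom_eval (Poly_Mapping.single i 1) v = v $ i"
proof -
  have "monom_eval (Poly_Mapping.single i 1) v = (\<Prod>j\<in>UNIV. if j = i then v $ i else 1)"
    unfolding monom_eval_def by (rule prod.cong) (auto simp: lookup_single when_def)
  then show ?thesis by simp
qed

lemma eval_superset:
  assumes "finite A" "Poly_Mapping.keys f \<subseteq> A"
  shows "eval f v = (\<Sum>e\<in>A. Poly_Mapping.lookup f e * monom_eval e v)"
  unfolding eval_def
  by (rule sum.mono_neutral_left) (use assms in \<open>auto simp: in_keys_iff\<close>)

lemma eval_0 [simp]: "eval 0 v = 0"
  by (simp add: eval_def)

lemma eval_1 [simp]: "eval 1 v = 1"
  by (simp add: eval_def)

lemma eval_add: "eval (f + g) v = eval f v + eval g v"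
proof -
  let ?A = "Poly_Mapping.keys f \<union> Poly_Mapping.keys g"
  have "eval (f + g) v = (\<Sum>e\<in>?A. Poly_Mapping.lookup (f + g) e * monom_eval e v)"
    by (rule eval_superset) (auto dest: set_mp[OF keys_add])
  also have "\<dots> = eval f v + eval g v"
    by (simp add: lookup_add distrib_right sum.distrib eval_superset[of ?A])
  finally show ?thesis .
qed

lemma eval_single: "eval (Poly_Mapping.single e c) v = c * monom_eval e v"
  by (cases "c = 0") (simp_all add: eval_def)

lemma eval_sum: "eval (sum h A) v = (\<Sum>x\<in>A. eval (h x) v)"
  by (induction A rule: infinite_finite_induct) (simp_all add: eval_add)

lemma sum_single_keys: "f = (\<Sum>e\<in>Poly_Mapping.keys f. Poly_Mapping.single e (Poly_Mapping.lookup f e))"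
proof (rule poly_mapping_eqI)
  fix k
  have "(\<Sum>e\<in>Poly_Mapping.keys f. Poly_Mapping.lookup (Poly_Mapping.single e (Poly_Mapping.lookup f e)) k)
      = (\<Sum>e\<in>Poly_Mapping.keys f. if e = k then Poly_Mapping.lookup f k else 0)"
    by (rule sum.cong) (auto simp: lookup_single when_def)
  then show "Poly_Mapping.lookup f k = Poly_Mapping.lookup (\<Sum>e\<in>Poly_Mapping.keys f. Poly_Mapping.single e (Poly_Mapping.lookup f e)) k"
    by (auto simp: lookup_sum in_keys_iff)
qed

lemma eval_mult: "eval (f * g) v = eval f v * eval g v"
proof -
  have "f * g = (\<Sum>a\<in>Poly_Mapping.keys f. Poly_Mapping.single a (Poly_Mapping.lookup f a))
      * (\<Sum>b\<in>Poly_Mapping.keys g. Poly_Mapping.single b (Poly_Mapping.lookup g b))"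
    using sum_single_keys[of f] sum_single_keys[of g] by simp
  also have "\<dots> = (\<Sum>a\<in>Poly_Mapping.keys f. \<Sum>b\<in>Poly_Mapping.keys g.
        Poly_Mapping.single (a + b) (Poly_Mapping.lookup f a * Poly_Mapping.lookup g b))"
    by (simp add: sum_product mult_single)
  finally have "eval (f * g) v = (\<Sum>a\<in>Poly_Mapping.keys f. \<Sum>b\<in>Poly_Mapping.keys g.
        (Poly_Mapping.lookup f a * Poly_Mapping.lookup g b) * (monom_eval a v * monom_eval b v))"
    by (simp add: eval_sum eval_single monom_eval_add)
  then show ?thesis
    by (simp add: eval_def sum_product mult_ac)
qed

lemma is_form_1: "is_form (1 :: 'k::zero_neq_one plane_ring)"
  by (auto simp: is_form_def)

lemma is_form_mult:
  fixes f g :: "'k::comm_semiring_1 plane_ring"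
  assumes "is_form f" "is_form g"
  shows "is_form (f * g)"
proof -
  obtain d d' where "\<forall>e\<in>Poly_Mapping.keys f. (\<Sum>i\<in>UNIV. Poly_Mapping.lookup e i) = d"
    "\<forall>e\<in>Poly_Mapping.keys g. (\<Sum>i\<in>UNIV. Poly_Mapping.lookup e i) = d'"
    using assms by (auto simp: is_form_def)
  then have "\<forall>e\<in>Poly_Mapping.keys (f * g). (\<Sum>i\<in>UNIV. Poly_Mapping.lookup e i) = d + d'"
    using keys_mult[of f g] by (fastforce simp: lookup_add sum.distrib)
  then show ?thesis by (auto simp: is_form_def)
qed

lemma vanishing_ideal_vanishes:
  assumes "f \<in> vanishing_ideal Z" "P \<in> Z"
  shows "vanishes_at f P"
  using assms(1) unfolding vanishing_ideal_def
proof (induction rule: ideal.span_induct_alt)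
  case base
  then show ?case by (simp add: vanishes_at_def)
next
  case (step c x y)
  then show ?case using assms(2) by (auto simp: vanishes_at_def eval_add eval_mult)
qed

lemma equiv_proj_rel: "equiv {v. v \<noteq> 0} (proj_rel :: ('k::field ^ 3) rel)"
proof (rule equivI)
  show "proj_rel \<subseteq> {v. v \<noteq> 0} \<times> {v. v \<noteq> 0}"
    by (auto simp: proj_rel_def)
  show "refl_on {v. v \<noteq> 0} proj_rel"
    by (auto simp: proj_rel_def refl_on_def intro!: exI[of _ 1])
  show "sym (proj_rel :: ('k ^ 3) rel)"
  proof (rule symI)
    fix v w :: "'k ^ 3"
    assume "(v, w) \<in> proj_rel"
    then obtain c where "v \<noteq> 0" "c \<noteq> 0" "w = c *s v"
      by (auto simp: proj_rel_def)
    then have "w \<noteq> 0" "v = inverse c *s w"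
      by (auto simp: vector_smult_assoc)
    then show "(w, v) \<in> proj_rel"
      using \<open>c \<noteq> 0\<close> unfolding proj_rel_def by (auto intro!: exI[of _ "inverse c"])
  qed
  show "trans (proj_rel :: ('k ^ 3) rel)"
  proof (rule transI)
    fix u v w :: "'k ^ 3"
    assume "(u, v) \<in> proj_rel" "(v, w) \<in> proj_rel"
    then obtain c d where "u \<noteq> 0" "c \<noteq> 0" "d \<noteq> 0" "w = d *s (c *s u)"
      by (auto simp: proj_rel_def)
    then show "(u, w) \<in> proj_rel"
      unfolding proj_rel_def by (auto simp: vector_smult_assoc intro!: exI[of _ "d * c"])
  qed
qed

definition line_form :: "'k::field ^ 3 \<Rightarrow> 3 \<Rightarrow> 3 \<Rightarrow> 'k plane_ring" where
  "line_form v i j = Poly_Mapping.single (Poly_Mapping.single j 1) (v $ i)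
     - Poly_Mapping.single (Poly_Mapping.single i 1) (v $ j)"

lemma line_form_eq: "line_form v i j = Poly_Mapping.single (Poly_Mapping.single j 1) (v $ i)
     + Poly_Mapping.single (Poly_Mapping.single i 1) (- (v $ j))"
  by (simp add: line_form_def single_uminus)

lemma eval_line_form: "eval (line_form v i j) w = v $ i * w $ j - v $ j * w $ i"
  by (simp only: line_form_eq eval_add eval_single monom_eval_single) simp

lemma is_form_line_form: "is_form (line_form v i j)"
proof -
  have deg: "(\<Sum>l\<in>UNIV. Poly_Mapping.lookup (Poly_Mapping.single (k :: 3) (1 :: nat)) l) = 1" for k
    by (simp add: lookup_single when_def)
  have "Poly_Mapping.keys (line_form v i j)
      \<subseteq> {Poly_Mapping.single j 1, Poly_Mapping.single i 1}"
    unfolding line_form_eq by (rule order_trans[OF keys_add]) (auto split: if_splits)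
  then show ?thesis using deg unfolding is_form_def by blast
qed

lemma separate_points:
  assumes "P \<in> proj_plane" "Q \<in> proj_plane" "P \<noteq> Q"
  shows "\<exists>f. is_form f \<and> vanishes_at f P \<and> \<not> vanishes_at f Q"
proof -
  obtain v where v: "v \<noteq> 0" "P = proj_rel `` {v}"
    using assms(1) by (auto simp: proj_plane_def elim!: quotientE)
  obtain w where w: "w \<noteq> 0" "Q = proj_rel `` {w}"
    using assms(2) by (auto simp: proj_plane_def elim!: quotientE)
  have nrel: "(v, w) \<notin> proj_rel"
    using equiv_class_eq[OF equiv_proj_rel] v w assms(3) by blast
  obtain i where i: "v $ i \<noteq> 0"
    using v(1) by (auto simp: vec_eq_iff)
  have "\<exists>j. eval (line_form v i j) w \<noteq> 0"
  proof (rule ccontr)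
    assume "\<not> ?thesis"
    then have "\<forall>j. v $ i * w $ j = v $ j * w $ i"
      by (simp add: eval_line_form)
    then have *: "w = (w $ i / v $ i) *s v"
      using i by (auto simp: vec_eq_iff field_simps)
    then have "w $ i / v $ i \<noteq> 0"
      using w(1) by (metis vector_smult_lzero)
    then have "(v, w) \<in> proj_rel"
      using * v(1) unfolding proj_rel_def by blast
    then show False using nrel by simp
  qed
  then obtain j where j: "eval (line_form v i j) w \<noteq> 0" by blast
  have "vanishes_at (line_form v i j) P"
    using v by (auto simp: vanishes_at_def proj_rel_def eval_line_form)
  moreover have "w \<in> Q"
    using w equiv_class_self[OF equiv_proj_rel] by blast
  ultimately show ?thesis
    using j is_form_line_form unfolding vanishes_at_def by blast
qed

lemma eval_form_scale:
  assumes "is_form f"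
  shows "\<exists>d. \<forall>v c. eval f (c *s v) = c ^ d * eval f v"
proof -
  obtain d where d: "\<And>e. e \<in> Poly_Mapping.keys f \<Longrightarrow> (\<Sum>i\<in>UNIV. Poly_Mapping.lookup e i) = d"
    using assms by (auto simp: is_form_def)
  have "eval f (c *s v) = c ^ d * eval f v" for v c
  proof -
    have "monom_eval e (c *s v) = c ^ d * monom_eval e v" if "e \<in> Poly_Mapping.keys f" for e
      using d[OF that]
      by (simp add: monom_eval_def power_mult_distrib prod.distrib flip: power_sum)
    then show ?thesis
      by (simp add: eval_def sum_distrib_left mult.left_commute)
  qed
  then show ?thesis by blast
qed

lemma form_vanishes_at_iff:
  assumes "is_form f" "P \<in> proj_plane" "v \<in> P"
  shows "vanishes_at f P \<longleftrightarrow> eval f v = 0"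
proof -
  have "w \<in> P \<Longrightarrow> (v, w) \<in> proj_rel" for w
    using quotient_eq_iff[OF equiv_proj_rel, of P P v w] assms(2,3)
    by (simp add: proj_plane_def)
  moreover obtain d where "\<forall>v c. eval f (c *s v) = c ^ d * eval f v"
    using eval_form_scale[OF assms(1)] by blast
  ultimately show ?thesis
    using assms(3) unfolding vanishes_at_def proj_rel_def by fastforce
qed

lemma separate_finite:
  assumes "finite Z" "Z \<subseteq> proj_plane" "Q \<in> proj_plane" "Q \<notin> Z"
  shows "\<exists>f. is_form f \<and> (\<forall>P\<in>Z. vanishes_at f P) \<and> \<not> vanishes_at f Q"
  using assms
proof (induction Z rule: finite_induct)
  case empty
  then obtain v where "v \<in> Q"
    using in_quotient_imp_non_empty[OF equiv_proj_rel] unfolding proj_plane_def by blast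
  then show ?case
    using is_form_1 by (intro exI[of _ 1]) (auto simp: vanishes_at_def)
next
  case (insert P Z)
  then obtain f where f: "is_form f" "\<forall>P\<in>Z. vanishes_at f P" "\<not> vanishes_at f Q"
    by auto
  obtain g where g: "is_form g" "vanishes_at g P" "\<not> vanishes_at g Q"
    using separate_points[of P Q] insert.prems by auto
  obtain v where v: "v \<in> Q" "eval f v \<noteq> 0"
    using f(3) by (auto simp: vanishes_at_def)
  then have "eval (f * g) v \<noteq> 0"
    using form_vanishes_at_iff[OF g(1) _ v(1)] g(3) insert.prems by (simp add: eval_mult)
  then have "\<not> vanishes_at (f * g) Q"
    using v(1) by (auto simp: vanishes_at_def)
  moreover have "\<forall>R\<in>insert P Z. vanishes_at (f * g) R"
    using f(2) g(2) by (auto simp: vanishes_at_def eval_mult)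
  ultimately show ?case
    using is_form_mult[OF f(1) g(1)] by blast
qed

lemma zero_locus_vanishing_ideal:
  assumes "finite Z" "Z \<subseteq> proj_plane"
  shows "zero_locus (vanishing_ideal Z) = Z"
proof
  show "Z \<subseteq> zero_locus (vanishing_ideal Z)"
    using assms(2) vanishing_ideal_vanishes by (auto simp: zero_locus_def)
  show "zero_locus (vanishing_ideal Z) \<subseteq> Z"
  proof
    fix Q assume Q: "Q \<in> zero_locus (vanishing_ideal Z)"
    show "Q \<in> Z"
    proof (rule ccontr)
      assume "Q \<notin> Z"
      then obtain f where f: "is_form f" "\<forall>P\<in>Z. vanishes_at f P" "\<not> vanishes_at f Q"
        using separate_finite[OF assms, of Q] Q unfolding zero_locus_def by blast
      then have "f \<in> vanishing_ideal Z"
        unfolding vanishing_ideal_def by (auto intro: ideal.span_base)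
      then show False using Q f(3) by (auto simp: zero_locus_def)
    qed
  qed
qed

theorem symbolic_power_vanishing_ideal:
  assumes "finite Z" "Z \<subseteq> proj_plane"
  shows "symbolic_power (vanishing_ideal Z) m = (\<Inter>P\<in>Z. ideal_power (vanishing_ideal {P}) m)"
  by (simp add: symbolic_power_def zero_locus_vanishing_ideal[OF assms])

end

theory Submission
  imports Defs "HOL-Analysis.Cartesian_Space"
begin

text \<open>
  The ideals are those of star configurations: take \<open>s\<close> lines in the plane, no three of them
  with a common point, and let \<open>I\<close> be the ideal of the points where two of the lines meet. Its
  resurgence lies between \<open>2 - 2 / (s - 1)\<close> and \<open>2 - 2 / s\<close>, and therefore in the required
  interval when \<open>s\<close> is large. An algebraically closed field is infinite, so that there are
  enough lines; they are taken from the family \<open>X + a Y + a\<^sup>2 Z = 0\<close>, and \<open>a\<close> ranges over a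
  finite set \<open>A\<close> of scalars.

  For the lower bound, the product of all lines vanishes doubly at every point. Its \<open>k\<close>-th
  power is thus in \<open>I\<^bsup>(2k)\<^esup>\<close>. It has degree \<open>k s\<close>, whereas the nonzero elements of \<open>I\<^sup>r\<close> have
  no terms of degree below \<open>r (s - 1)\<close>. So \<open>k s < r (s - 1)\<close> prevents containment
  (\<open>star_noncontainment\<close>).

  For the upper bound, the key is that symbolic powers behave as they do for monomial ideals:
  \<open>I\<^bsup>(m)\<^esup>\<close> is generated by the products of lines in which the exponents of any two lines add
  up to at least \<open>m\<close> (\<open>mem_span_line_products\<close>). This is proved by restricting to one line at
  a time. A polynomial vanishing to order \<open>m\<close> at the points of a line agrees on that line with
  a multiple of the \<open>m\<close>-th powers of the other lines; the difference is divisible by the line,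
  and the argument is repeated for the quotient. The orders of vanishing of a quotient are
  controlled by cancellation laws for the ideals \<open>(x, y)\<^sup>m\<close>. For linear forms these laws
  follow from the primality of the ideals generated by one or two lines, which are kernels of
  substitutions.

  It remains to compare exponents. A product of lines lies in \<open>I\<^sup>r\<close> when the amounts by which
  its exponents fall short of \<open>r\<close> add up to at most \<open>r\<close> (\<open>line_product_mem_ideal_power\<close>), and
  this holds for all generators of \<open>I\<^bsup>(m)\<^esup>\<close> when \<open>m s \<ge> 2 r (s - 1)\<close> (\<open>deficiency_le\<close>). Hence
  \<open>I\<^bsup>(m)\<^esup>\<close> can fail to be contained in \<open>I\<^sup>r\<close> only if \<open>m / r < 2 - 2 / s\<close>.
\<close>

text \<open>
  The interpretation of multiplication as a scalar multiplication turns the associativity law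
  into a simplification rule directed against the one that normalises products. It is removed,
  as the two do not terminate together.
\<close>

declare ideal.scale_scale [simp del]

section \<open>Powers of an ideal generated by two elements\<close>

text \<open>
  The power \<open>(x, y)\<^sup>m\<close> of the ideal generated by \<open>x\<close> and \<open>y\<close>, written by means of the identity
  \<open>(x, y)\<^bsup>m + 1\<^esup> = (y\<^bsup>m + 1\<^esup>) + x (x, y)\<^sup>m\<close>. This form splits an element into its value modulo
  \<open>x\<close> and a multiple of \<open>x\<close>, which is how all the cancellation laws below are proved. Those
  laws say that \<open>x\<close> and \<open>y\<close> have order exactly one, and a third element order zero, for the
  order of vanishing defined by the powers of \<open>(x, y)\<close>, provided that \<open>y\<close> is regular modulo
  \<open>x\<close> and the third element regular modulo \<open>(x, y)\<close>.
\<close>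

primrec pair_power :: "'a::idom \<Rightarrow> 'a \<Rightarrow> nat \<Rightarrow> 'a set" where
  "pair_power x y 0 = UNIV"
| "pair_power x y (Suc m) = {c * y ^ Suc m + x * k | c k. k \<in> pair_power x y m}"

lemma pair_power_SucI: "k \<in> pair_power x y m \<Longrightarrow> c * y ^ Suc m + x * k \<in> pair_power x y (Suc m)"
  by auto

lemma pair_power_SucE:
  assumes "f \<in> pair_power x y (Suc m)"
  obtains c k where "f = c * y ^ Suc m + x * k" "k \<in> pair_power x y m"
  using assms by auto

lemma pair_power_0_mem [simp]: "0 \<in> pair_power x y m"
proof (induction m)
  case (Suc m)
  then show ?case using pair_power_SucI[of 0 x y m 0] by simp
qed simp

lemma pair_power_add: "f \<in> pair_power x y m \<Longrightarrow> g \<in> pair_power x y m \<Longrightarrow> f + g \<in> pair_power x y m"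
proof (induction m arbitrary: f g)
  case (Suc m)
  obtain c k where f: "f = c * y ^ Suc m + x * k" "k \<in> pair_power x y m"
    using Suc.prems(1) by (rule pair_power_SucE)
  obtain d l where g: "g = d * y ^ Suc m + x * l" "l \<in> pair_power x y m"
    using Suc.prems(2) by (rule pair_power_SucE)
  have "f + g = (c + d) * y ^ Suc m + x * (k + l)"
    unfolding f g by (simp only: algebra_simps)
  then show ?case
    using Suc.IH[OF f(2) g(2)] pair_power_SucI by metis
qed simp

lemma pair_power_mult: "f \<in> pair_power x y m \<Longrightarrow> c * f \<in> pair_power x y m"
proof (induction m arbitrary: f)
  case (Suc m)
  obtain d k where f: "f = d * y ^ Suc m + x * k" "k \<in> pair_power x y m"
    using Suc.prems(1) by (rule pair_power_SucE)
  have "c * f = (c * d) * y ^ Suc m + x * (c * k)"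
    unfolding f by (simp only: algebra_simps)
  then show ?case
    using Suc.IH[OF f(2)] pair_power_SucI by metis
qed simp

lemma pair_power_diff: "f \<in> pair_power x y m \<Longrightarrow> g \<in> pair_power x y m \<Longrightarrow> f - g \<in> pair_power x y m"
  using pair_power_add[of f x y m "(- 1) * g"] pair_power_mult[of g x y m "- 1"] by simp

lemma subspace_pair_power: "ideal.subspace (pair_power x y m)"
  by (simp add: ideal.subspace_def pair_power_add pair_power_mult)

lemma fst_mult_mem: "f \<in> pair_power x y m \<Longrightarrow> x * f \<in> pair_power x y (Suc m)"
  using pair_power_SucI[of f x y m 0] by simp

lemma snd_mult_mem: "f \<in> pair_power x y m \<Longrightarrow> y * f \<in> pair_power x y (Suc m)"
proof (induction m arbitrary: f)
  case 0
  show ?case using pair_power_SucI[of 0 x y 0 f] by (simp add: mult.commute)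
next
  case (Suc m)
  obtain d k where f: "f = d * y ^ Suc m + x * k" "k \<in> pair_power x y m"
    using Suc.prems(1) by (rule pair_power_SucE)
  have "y * f = d * y ^ Suc (Suc m) + x * (y * k)"
    unfolding f by (simp only: power_Suc algebra_simps)
  then show ?case
    using Suc.IH[OF f(2)] pair_power_SucI by metis
qed

lemma powers_mem: "x ^ i * y ^ j * f \<in> pair_power x y (i + j)"
proof (induction i)
  case 0
  show ?case
  proof (induction j)
    case (Suc j)
    have "x ^ 0 * y ^ Suc j * f = y * (x ^ 0 * y ^ j * f)"
      by (simp only: power_Suc mult_ac)
    then show ?case using snd_mult_mem[OF Suc.IH] by (metis add_Suc_right)
  qed simp
next
  case (Suc i)
  have "x ^ Suc i * y ^ j * f = x * (x ^ i * y ^ j * f)"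
    by (simp only: power_Suc mult_ac)
  then show ?case
    using fst_mult_mem[OF Suc.IH] by (metis add_Suc)
qed

lemma pair_power_antimono:
  assumes "m \<le> n" shows "pair_power x y n \<subseteq> pair_power x y m"
proof -
  have step: "pair_power x y (Suc m) \<subseteq> pair_power x y m" for m
  proof (induction m)
    case (Suc m)
    show ?case
    proof
      fix f assume "f \<in> pair_power x y (Suc (Suc m))"
      then obtain c k where f: "f = c * y ^ Suc (Suc m) + x * k" "k \<in> pair_power x y (Suc m)"
        by (rule pair_power_SucE)
      have "f = (c * y) * y ^ Suc m + x * k"
        unfolding f by simp
      then show "f \<in> pair_power x y (Suc m)"
        using f(2) Suc.IH pair_power_SucI by blast
    qed
  qed simp
  show ?thesis by (rule lift_Suc_antimono_le[of "pair_power x y", OF step assms])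
qed

lemma pair_power_imp_dvd_diff:
  assumes "f \<in> pair_power x y m"
  obtains d where "x dvd f - d * y ^ m"
proof (cases m)
  case 0
  then show ?thesis using that[of f] by simp
next
  case (Suc n)
  then obtain c k where "f = c * y ^ Suc n + x * k"
    using assms pair_power_SucE by metis
  then show ?thesis using that[of c] Suc by simp
qed

lemma dvd_power_mult_cancel:
  fixes x y :: "'a::idom"
  assumes y: "\<And>g. x dvd y * g \<Longrightarrow> x dvd g" and "x dvd y ^ i * g"
  shows "x dvd g"
  using assms(2)
proof (induction i)
  case (Suc i)
  then have "x dvd y * (y ^ i * g)"
    by (simp only: power_Suc mult.assoc)
  then have "x dvd y ^ i * g"
    by (rule y)
  then show ?case
    by (rule Suc.IH)
qed simp

text \<open>
  In \<open>x h = c y\<^bsup>m\<^esup> + x k\<close> the coefficient \<open>c\<close> is divisible by \<open>x\<close>, because \<open>y\<close> is regular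
  modulo \<open>x\<close>; cancelling \<open>x\<close> leaves \<open>h\<close> as the sum of a multiple of \<open>y\<^bsup>m\<^esup>\<close> and of \<open>k\<close>.
\<close>

lemma cancel_fst:
  assumes x: "x \<noteq> 0" and y: "\<And>g. x dvd y * g \<Longrightarrow> x dvd g"
    and mem: "x * h \<in> pair_power x y m"
  shows "h \<in> pair_power x y (m - 1)"
proof (cases m)
  case (Suc n)
  obtain c k where ck: "x * h = c * y ^ Suc n + x * k" "k \<in> pair_power x y n"
    using mem unfolding Suc by (rule pair_power_SucE)
  have ypow: "x dvd y ^ i * g \<Longrightarrow> x dvd g" for i g
    using y by (rule dvd_power_mult_cancel)
  have "c * y ^ Suc n = x * (h - k)"
    unfolding right_diff_distrib ck(1) by (simp only: add_diff_cancel_right')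
  then have "x dvd y ^ Suc n * c"
    by (simp add: mult.commute)
  then obtain c' where c': "c = x * c'"
    using ypow dvdE by metis
  have "x * h = x * (y ^ Suc n * c' + k)"
    using ck(1) unfolding c' by (simp only: algebra_simps)
  then have h: "h = y ^ Suc n * c' + k"
    using x by simp
  have "y ^ Suc n * c' \<in> pair_power x y (Suc n)"
    using powers_mem[of x 0 y "Suc n" c'] by simp
  then have "y ^ Suc n * c' \<in> pair_power x y n"
    using pair_power_antimono[of n "Suc n" x y] by (meson in_mono lessI less_imp_le)
  then have "h \<in> pair_power x y n"
    unfolding h using ck(2) by (rule pair_power_add)
  then show ?thesis
    unfolding Suc by simp
qed simp

lemma cancel_snd:
  assumes x: "x \<noteq> 0" and y: "\<And>g. x dvd y * g \<Longrightarrow> x dvd g"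
    and mem: "y * h \<in> pair_power x y m"
  shows "h \<in> pair_power x y (m - 1)"
  using mem
proof (induction m arbitrary: h)
  case (Suc m)
  obtain c k where ck: "y * h = c * y ^ Suc m + x * k" "k \<in> pair_power x y m"
    using Suc.prems by (rule pair_power_SucE)
  have "y * (h - c * y ^ m) = x * k"
    unfolding right_diff_distrib ck(1) power_Suc
    by (simp only: mult.left_commute add_diff_cancel_left')
  then have "x dvd h - c * y ^ m"
    by (metis dvd_triv_left y)
  then obtain k' where k': "h - c * y ^ m = x * k'" ..
  have h: "h = c * y ^ m + x * k'"
    using k' by (simp only: diff_eq_eq add.commute)
  have "x * (y * k') = x * k"
    using ck(1) unfolding h power_Suc
    by (simp only: distrib_left mult.left_commute add_left_cancel)
  then have "y * k' \<in> pair_power x y m"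
    using x ck(2) by simp
  then have "k' \<in> pair_power x y (m - 1)"
    by (rule Suc.IH)
  then show ?case
    unfolding h by (cases m) (auto simp del: power_Suc)
qed simp

text \<open>
  Membership in \<open>(x, y\<^sup>n)\<close> is expressed as a congruence modulo \<open>x\<close>. If \<open>z\<close> is regular modulo
  \<open>(x, y)\<close>, it is regular modulo \<open>(x, y\<^sup>n)\<close>: once \<open>g = e y\<^sup>n\<close> is known modulo \<open>x\<close>, the factor
  \<open>y\<^sup>n\<close> can be cancelled from the hypothesis for \<open>n + 1\<close>, which then says that \<open>z e\<close>, hence
  \<open>e\<close>, lies in \<open>(x, y)\<close>.
\<close>

lemma cancel_mod_power:
  fixes x y z :: "'a::idom"
  assumes y: "\<And>g. x dvd y * g \<Longrightarrow> x dvd g"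
    and z: "\<And>g d. x dvd z * g - d * y \<Longrightarrow> \<exists>d'. x dvd g - d' * y"
    and mem: "x dvd z * g - d * y ^ n"
  shows "\<exists>d'. x dvd g - d' * y ^ n"
  using mem
proof (induction n arbitrary: d)
  case 0
  show ?case by (intro exI[of _ g]) simp
next
  case (Suc n)
  have ypow: "x dvd y ^ i * g \<Longrightarrow> x dvd g" for i g
    using y by (rule dvd_power_mult_cancel)
  have "x dvd z * g - (d * y) * y ^ n"
    using Suc.prems by (simp only: power_Suc mult.assoc)
  then obtain e where e: "x dvd g - e * y ^ n"
    using Suc.IH by blast
  have "y ^ n * (z * e - d * y) = (z * g - d * y ^ Suc n) - z * (g - e * y ^ n)"
    by (simp only: power_Suc algebra_simps)
  then have "x dvd z * e - d * y"
    using e Suc.prems ypow by (metis dvd_diff dvd_mult)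
  then obtain d' where d': "x dvd e - d' * y"
    using z by blast
  have "g - d' * y ^ Suc n = (g - e * y ^ n) + y ^ n * (e - d' * y)"
    by (simp only: power_Suc algebra_simps)
  then show ?case
    using e d' by (metis dvd_add dvd_mult)
qed

text \<open>
  The leading coefficient of \<open>h\<close> is found modulo \<open>x\<close> by the preceding lemma; the rest is a
  multiple of \<open>x\<close>, from which \<open>x\<close> is cancelled in order to use the induction hypothesis.
\<close>

lemma cancel_third:
  assumes x: "x \<noteq> 0" and y: "\<And>g. x dvd y * g \<Longrightarrow> x dvd g"
    and z: "\<And>g d. x dvd z * g - d * y \<Longrightarrow> \<exists>d'. x dvd g - d' * y"
    and mem: "z * h \<in> pair_power x y m"
  shows "h \<in> pair_power x y m"
  using mem
proof (induction m arbitrary: h)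
  case (Suc m)
  obtain d where "x dvd z * h - d * y ^ Suc m"
    using Suc.prems by (rule pair_power_imp_dvd_diff)
  with y z have "\<exists>d'. x dvd h - d' * y ^ Suc m"
    by (rule cancel_mod_power)
  then obtain d' where "x dvd h - d' * y ^ Suc m" ..
  then obtain k where k: "h - d' * y ^ Suc m = x * k" ..
  have h: "h = d' * y ^ Suc m + x * k"
    using k by (simp only: diff_eq_eq add.commute)
  have "y ^ Suc m * (z * d') \<in> pair_power x y (Suc m)"
    using powers_mem[of x 0 y "Suc m" "z * d'"] by simp
  moreover have "z * h = x * (z * k) + y ^ Suc m * (z * d')"
    unfolding h by (simp only: distrib_left mult_ac add.commute)
  then have "x * (z * k) = z * h - y ^ Suc m * (z * d')"
    by (simp only: add_diff_cancel_right')
  ultimately have "x * (z * k) \<in> pair_power x y (Suc m)"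
    using Suc.prems pair_power_diff by metis
  then have "z * k \<in> pair_power x y m"
    using cancel_fst[OF x y] by fastforce
  then have "k \<in> pair_power x y m"
    by (rule Suc.IH)
  then show ?case
    unfolding h by (rule pair_power_SucI)
qed simp

section \<open>Substitution of polynomials for the variables\<close>

definition const :: "'k::field \<Rightarrow> 'k plane_ring" where
  "const c = Poly_Mapping.single 0 c"

definition var :: "3 \<Rightarrow> 'k::field plane_ring" where
  "var i = Poly_Mapping.single (Poly_Mapping.single i 1) 1"

definition subst :: "'k::field plane_ring ^ 3 \<Rightarrow> 'k plane_ring \<Rightarrow> 'k plane_ring" where
  "subst v f = (\<Sum>e\<in>Poly_Mapping.keys f. const (Poly_Mapping.lookup f e) * monom_eval e v)"

lemma const_0 [simp]: "const 0 = 0"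
  and const_1 [simp]: "const 1 = 1"
  and const_add: "const (a + b) = const a + const b"
  and const_diff: "const (a - b) = const a - const b"
  and const_uminus: "const (- a) = - const a"
  and const_mult: "const (a * b) = const a * const b"
  by (simp_all add: const_def single_add single_diff single_uminus mult_single)

lemma const_power: "const (a ^ n) = const a ^ n"
  by (induction n) (simp_all add: const_mult)

lemma const_sum: "const (sum g A) = (\<Sum>x\<in>A. const (g x))"
  by (induction A rule: infinite_finite_induct) (simp_all add: const_add)

lemma const_prod: "const (prod g A) = (\<Prod>x\<in>A. const (g x))"
  by (induction A rule: infinite_finite_induct) (simp_all add: const_mult)

lemma eval_const [simp]: "eval (const c) v = c"
  by (simp add: const_def eval_single)

lemma eval_var [simp]: "eval (var i) v = v $ i"
  by (simp only: var_def eval_single monom_eval_single mult_1)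

lemma eval_prod: "eval (prod g A) v = (\<Prod>x\<in>A. eval (g x) v)"
  by (induction A rule: infinite_finite_induct) (simp_all add: eval_mult)

lemma eval_power: "eval (f ^ n) v = eval f v ^ n"
  by (induction n) (simp_all add: eval_mult)

lemma eval_uminus: "eval (- f) v = - eval f (v :: 'k::field ^ 3)"
  using eval_add[of f "- f" v] by (simp add: eq_neg_iff_add_eq_0 add.commute)

lemma eval_diff: "eval (f - g) v = eval f v - eval g (v :: 'k::field ^ 3)"
  using eval_add[of f "- g" v] by (simp add: eval_uminus)

lemma subst_superset:
  assumes "finite A" "Poly_Mapping.keys f \<subseteq> A"
  shows "subst v f = (\<Sum>e\<in>A. const (Poly_Mapping.lookup f e) * monom_eval e v)"
  unfolding subst_def
  by (rule sum.mono_neutral_left) (use assms in \<open>auto simp: in_keys_iff\<close>)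

lemma subst_0 [simp]: "subst v 0 = 0"
  by (simp add: subst_def)

lemma subst_add: "subst v (f + g) = subst v f + subst v g"
proof -
  let ?A = "Poly_Mapping.keys f \<union> Poly_Mapping.keys g"
  have "subst v (f + g) = (\<Sum>e\<in>?A. const (Poly_Mapping.lookup (f + g) e) * monom_eval e v)"
    by (rule subst_superset) (auto dest: set_mp[OF keys_add])
  also have "\<dots> = subst v f + subst v g"
    by (simp add: lookup_add const_add distrib_right sum.distrib subst_superset[of ?A])
  finally show ?thesis .
qed

lemma subst_single: "subst v (Poly_Mapping.single e c) = const c * monom_eval e v"
  by (cases "c = 0") (simp_all add: subst_def)

lemma subst_sum: "subst v (sum h A) = (\<Sum>x\<in>A. subst v (h x))"
  by (induction A rule: infinite_finite_induct) (simp_all add: subst_add)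

lemma subst_mult: "subst v (f * g) = subst v f * subst v g"
proof -
  have "f * g = (\<Sum>a\<in>Poly_Mapping.keys f. Poly_Mapping.single a (Poly_Mapping.lookup f a))
      * (\<Sum>b\<in>Poly_Mapping.keys g. Poly_Mapping.single b (Poly_Mapping.lookup g b))"
    using sum_single_keys[of f] sum_single_keys[of g] by simp
  also have "\<dots> = (\<Sum>a\<in>Poly_Mapping.keys f. \<Sum>b\<in>Poly_Mapping.keys g.
        Poly_Mapping.single (a + b) (Poly_Mapping.lookup f a * Poly_Mapping.lookup g b))"
    by (simp add: sum_product mult_single)
  finally have "subst v (f * g) = (\<Sum>a\<in>Poly_Mapping.keys f. \<Sum>b\<in>Poly_Mapping.keys g.
        const (Poly_Mapping.lookup f a * Poly_Mapping.lookup g b) * (monom_eval a v * monom_eval b v))"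
    by (simp add: subst_sum subst_single monom_eval_add)
  then show ?thesis
    by (simp only: subst_def sum_product mult_ac const_mult)
qed

lemma subst_const [simp]: "subst v (const c) = const c"
  by (simp only: const_def[of c] subst_single monom_eval_0 mult_1_right)

lemma subst_var [simp]: "subst v (var i) = v $ i"
  by (simp only: var_def subst_single monom_eval_single const_1 mult_1)

lemma subst_1 [simp]: "subst v 1 = 1"
  using subst_const[of v 1] by simp

lemma subst_prod: "subst v (prod g A) = (\<Prod>x\<in>A. subst v (g x))"
  by (induction A rule: infinite_finite_induct) (simp_all add: subst_mult)

lemma subst_power: "subst v (f ^ n) = subst v f ^ n"
  by (induction n) (simp_all add: subst_mult)

lemma eval_monom_eval: "eval (monom_eval e v) w = monom_eval e (\<chi> i. eval (v $ i) w)"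
  by (simp add: monom_eval_def eval_prod eval_power)

lemma eval_subst: "eval (subst v f) w = eval f (\<chi> i. eval (v $ i) w)"
proof -
  have "eval (subst v f) w = (\<Sum>e\<in>Poly_Mapping.keys f.
      Poly_Mapping.lookup f e * monom_eval e (\<chi> i. eval (v $ i) w))"
    by (simp add: subst_def eval_sum eval_mult eval_monom_eval)
  then show ?thesis by (simp add: eval_def)
qed

lemma monom_eval_var: "monom_eval e (\<chi> i. var i) = Poly_Mapping.single e (1 :: 'k::field)"
proof -
  have pow: "var i ^ n = (Poly_Mapping.single (Poly_Mapping.single i n) 1 :: 'k plane_ring)" for i n
    by (induction n) (simp_all add: var_def mult_single flip: single_add)
  have single_prod: "(\<Prod>i\<in>A. Poly_Mapping.single (g i) (1 :: 'k)) = Poly_Mapping.single (sum g A) 1"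
    if "finite A" for A :: "3 set" and g :: "3 \<Rightarrow> (3 \<Rightarrow>\<^sub>0 nat)"
    using that by (induction A rule: finite_induct) (simp_all add: mult_single)
  have "(\<Sum>i\<in>UNIV. Poly_Mapping.single i (Poly_Mapping.lookup e i)) = e"
    by (rule poly_mapping_eqI) (simp add: lookup_sum lookup_single when_def)
  then show ?thesis
    by (simp add: monom_eval_def pow single_prod)
qed

lemma subst_vars [simp]: "subst (\<chi> i. var i) f = f"
proof -
  have "subst (\<chi> i. var i) f
      = (\<Sum>e\<in>Poly_Mapping.keys f. Poly_Mapping.single e (Poly_Mapping.lookup f e))"
    by (simp add: subst_def monom_eval_var const_def mult_single)
  then show ?thesis
    using sum_single_keys[of f] by simp
qed

lemma monom_eval_cong_ideal:
  assumes Q: "ideal.subspace Q" and uv: "\<And>i. u $ i - v $ i \<in> Q"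
  shows "monom_eval e u - monom_eval e v \<in> Q"
proof -
  have mult: "a * c - b * d \<in> Q" if "a - b \<in> Q" "c - d \<in> Q" for a b c d
  proof -
    have "a * c - b * d = c * (a - b) + b * (c - d)"
      by (simp add: algebra_simps)
    then show ?thesis
      using that Q by (simp add: ideal.subspace_add ideal.subspace_scale)
  qed
  have pow: "a ^ n - b ^ n \<in> Q" if "a - b \<in> Q" for a b n
    by (induction n) (use that mult ideal.subspace_0[OF Q] in auto)
  have "(\<Prod>i\<in>A. u $ i ^ Poly_Mapping.lookup e i) - (\<Prod>i\<in>A. v $ i ^ Poly_Mapping.lookup e i) \<in> Q"
    for A
    by (induction A rule: infinite_finite_induct)
      (use pow[OF uv] mult ideal.subspace_0[OF Q] in auto)
  then show ?thesis
    unfolding monom_eval_def .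
qed

text \<open>
  Substitution of \<open>v\<close> and the identity are two homomorphisms that agree modulo \<open>Q\<close> on the
  variables. This is how ideals are recognised below as kernels of substitutions, and thus as
  prime ideals.
\<close>

lemma subst_cong_ideal:
  assumes Q: "ideal.subspace Q" and "\<And>i. var i - v $ i \<in> Q"
  shows "f - subst v f \<in> Q"
proof -
  have "subst (\<chi> i. var i) f - subst v f
      = (\<Sum>e\<in>Poly_Mapping.keys f. const (Poly_Mapping.lookup f e)
          * (monom_eval e (\<chi> i. var i) - monom_eval e v))"
    by (simp add: subst_def sum_subtractf right_diff_distrib)
  also have "\<dots> \<in> Q"
    using monom_eval_cong_ideal[OF Q, of "\<chi> i. var i" v] assms(2)
    by (intro ideal.subspace_sum[OF Q] ideal.subspace_scale[OF Q]) simp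
  finally show ?thesis by simp
qed

section \<open>A family of lines in general position\<close>

text \<open>
  The lines \<open>X + a Y + a\<^sup>2 Z = 0\<close> are tangent to a conic when 2 is invertible. In every
  characteristic no three of them have a common point, by the Vandermonde determinant.
\<close>

definition line :: "'k::field \<Rightarrow> 'k plane_ring" where
  "line a = var 1 + const a * var 2 + const (a ^ 2) * var 3"

text \<open>
  The line with parameter \<open>c\<close> takes the value \<open>(c - a) (c - b)\<close> here, which makes this the
  common point of the lines with parameters \<open>a\<close> and \<open>b\<close>, and shows that no other line of the
  family contains it.
\<close>

definition meet :: "'k::field \<Rightarrow> 'k \<Rightarrow> 'k ^ 3" where
  "meet a b = vector [a * b, - (a + b), 1]"

lemma eval_line: "eval (line a) w = w $ 1 + a * w $ 2 + a ^ 2 * w $ 3"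
  by (simp add: line_def eval_add eval_mult)

lemma subst_line: "subst v (line a) = v $ 1 + const a * v $ 2 + const (a ^ 2) * v $ 3"
  by (simp add: line_def subst_add subst_mult)

lemma eval_line_meet: "eval (line c) (meet a b) = (c - a) * (c - b)"
  by (simp add: eval_line meet_def vector_3 power2_eq_square algebra_simps)

lemma line_nonzero: "line a \<noteq> (0 :: 'k::field plane_ring)"
proof
  assume "line a = (0 :: 'k plane_ring)"
  then have "eval (line a) (vector [1, 0, 0]) = 0" by simp
  then show False by (simp add: eval_line)
qed

lemma is_form_line: "is_form (line a)"
proof -
  have deg: "(\<Sum>l\<in>UNIV. Poly_Mapping.lookup (Poly_Mapping.single (k :: 3) (1 :: nat)) l) = 1" for k
    by (simp add: lookup_single when_def)
  have "Poly_Mapping.keys (line a) \<subseteq> {Poly_Mapping.single 1 1, Poly_Mapping.single 2 1, Poly_Mapping.single 3 1}"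
    unfolding line_def var_def const_def
    by (intro order_trans[OF keys_add] Un_least) (auto simp: mult_single split: if_splits)
  then show ?thesis using deg unfolding is_form_def by blast
qed

lemma is_form_prod: "(\<And>x. x \<in> A \<Longrightarrow> is_form (g x)) \<Longrightarrow> is_form (prod g A :: 'k::field plane_ring)"
  by (induction A rule: infinite_finite_induct) (auto simp: is_form_1 is_form_mult)

text \<open>
  Eliminating \<open>X\<close> is a homomorphism into a domain whose kernel is the ideal generated by
  \<open>line a\<close>, and it does not kill the other lines.
\<close>

lemma line_prime:
  fixes a b :: "'k::field"
  assumes "a \<noteq> b" "line a dvd line b * g"
  shows "line a dvd g"
proof -
  define v :: "'k plane_ring ^ 3" where
    "v = vector [- const a * var 2 - const (a ^ 2) * var 3, var 2, var 3]"
  have Q: "ideal.subspace {f. line a dvd f}"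
    by (auto simp: ideal.subspace_def)
  have "\<forall>i. var i - v $ i \<in> {f. line a dvd f}"
    unfolding forall_3 by (simp add: v_def line_def algebra_simps)
  then have cong: "line a dvd f - subst v f" for f
    using subst_cong_ideal[OF Q] by blast
  have "subst v (line a) = 0"
    by (simp add: subst_line v_def)
  then have "subst v (line b) * subst v g = 0"
    using assms(2) by (metis dvdE mult_zero_left subst_mult)
  moreover have "eval (subst v (line b)) (vector [0, 1, 0]) = b - a"
    by (simp add: eval_subst eval_line v_def eval_mult eval_diff eval_uminus)
  then have "subst v (line b) \<noteq> 0"
    using assms(1) by auto
  ultimately show ?thesis
    using cong[of g] by simp
qed

text \<open>
  Substituting the multiple \<open>Z p\<close> of a point \<open>p\<close> restricts a polynomial to the line through
  the origin that \<open>p\<close> spans in affine space. For nonzero \<open>p\<close> the kernel is the ideal of the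
  point; a polynomial that merely vanishes at the vector \<open>p\<close> need not lie in this ideal unless
  it is a form.
\<close>

definition cone :: "'k::field ^ 3 \<Rightarrow> 'k plane_ring ^ 3" where
  "cone p = (\<chi> i. const (p $ i) * var 3)"

lemma eval_subst_cone: "eval (subst (cone p) f) (vector [0, 0, 1]) = eval f p"
proof -
  have "(\<chi> i. eval (cone p $ i) (vector [0, 0, 1])) = p"
    by (simp add: cone_def eval_mult vec_eq_iff)
  then show ?thesis by (simp add: eval_subst)
qed

text \<open>
  A form of degree \<open>d\<close> restricts to its value at \<open>p\<close> times the \<open>d\<close>-th power of the variable.
\<close>

lemma subst_cone_form:
  assumes "is_form f" "eval f p = 0"
  shows "subst (cone p) f = 0"
proof -
  obtain d where d: "\<And>e. e \<in> Poly_Mapping.keys f \<Longrightarrow> (\<Sum>i\<in>UNIV. Poly_Mapping.lookup e i) = d"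
    using assms(1) by (auto simp: is_form_def)
  have "monom_eval e (cone p) = const (monom_eval e p) * var 3 ^ d" if "e \<in> Poly_Mapping.keys f" for e
    using d[OF that]
    by (simp add: monom_eval_def cone_def power_mult_distrib prod.distrib const_prod const_power
        flip: power_sum)
  then have "subst (cone p) f = (\<Sum>e\<in>Poly_Mapping.keys f.
      const (Poly_Mapping.lookup f e) * (const (monom_eval e p) * var 3 ^ d))"
    unfolding subst_def by (intro sum.cong refl) (simp only:)
  also have "\<dots> = const (eval f p) * var 3 ^ d"
    by (simp only: eval_def const_sum const_mult sum_distrib_right mult.assoc)
  finally show ?thesis
    using assms(2) by simp
qed

text \<open>
  The ideal of the point where two lines meet is generated by the lines: these generate
  \<open>X - a b Z\<close> and \<open>Y + (a + b) Z\<close>, so that every polynomial is congruent to its restriction to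
  the cone over the point.
\<close>

lemma pair_ideal_iff:
  assumes "a \<noteq> b"
  shows "(\<exists>d. line a dvd f - d * line b) \<longleftrightarrow> subst (cone (meet a b)) f = 0"
proof
  let ?v = "cone (meet a b)"
  have kill: "subst ?v (line a) = 0" "subst ?v (line b) = 0"
    by (auto intro!: subst_cone_form simp: is_form_line eval_line_meet)
  assume "\<exists>d. line a dvd f - d * line b"
  then obtain d k where "f - d * line b = line a * k"
    by (auto elim: dvdE)
  then have "f = line a * k + d * line b"
    by (simp only: diff_eq_eq)
  then show "subst ?v f = 0"
    by (simp add: subst_add subst_mult kill)
next
  let ?v = "cone (meet a b)"
  let ?Q = "{f. \<exists>d. line a dvd f - d * line b}"
  have Q: "ideal.subspace ?Q"
    unfolding ideal.subspace_def
  proof (intro conjI ballI allI)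
    show "0 \<in> ?Q" by (auto intro: exI[of _ 0])
  next
    fix f g assume "f \<in> ?Q" "g \<in> ?Q"
    then obtain d e where "line a dvd f - d * line b" "line a dvd g - e * line b" by auto
    then have "line a dvd (f - d * line b) + (g - e * line b)" by (rule dvd_add)
    moreover have "(f - d * line b) + (g - e * line b) = (f + g) - (d + e) * line b"
      by (simp add: algebra_simps)
    ultimately show "f + g \<in> ?Q" by auto
  next
    fix c f assume "f \<in> ?Q"
    then obtain d where "line a dvd f - d * line b" by auto
    then have "line a dvd c * (f - d * line b)" by (rule dvd_mult)
    moreover have "c * (f - d * line b) = c * f - (c * d) * line b"
      by (simp add: algebra_simps)
    ultimately show "c * f \<in> ?Q" by auto
  qed
  define u where "u = const (inverse (b - a))"
  have u: "u * const (b - a) = 1"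
    using assms by (simp add: u_def flip: const_mult)
  have v: "?v $ 1 = const (a * b) * var 3" "?v $ 2 = - const (a + b) * var 3" "?v $ 3 = var 3"
    by (simp_all add: cone_def meet_def vector_3 const_uminus const_diff const_add)
  have "line b - line a = const (b - a) * (var 2 + const (a + b) * var 3)"
    by (simp add: line_def const_add const_diff const_mult power2_eq_square algebra_simps)
  then have "u * (line b - line a) = var 2 + const (a + b) * var 3"
    using u by (simp flip: mult.assoc)
  then have "(var 2 - ?v $ 2) - u * line b = line a * (- u)"
    unfolding v by (simp add: algebra_simps)
  then have 2: "var 2 - ?v $ 2 \<in> ?Q"
    by (metis (mono_tags, lifting) dvd_triv_left mem_Collect_eq)
  have "var 1 - ?v $ 1 = line a + (- const a) * (var 2 - ?v $ 2)"
    unfolding v by (simp add: line_def const_add const_mult power2_eq_square algebra_simps)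
  moreover have "line a \<in> ?Q"
    by (auto intro!: exI[of _ 0])
  ultimately have 1: "var 1 - ?v $ 1 \<in> ?Q"
    using ideal.subspace_add[OF Q _ ideal.subspace_scale[OF Q 2]] by (simp only:)
  have 3: "var 3 - ?v $ 3 \<in> ?Q"
    using ideal.subspace_0[OF Q] unfolding v by simp
  have "\<forall>i. var i - ?v $ i \<in> ?Q"
    unfolding forall_3 using 1 2 3 by blast
  then have "f - subst ?v f \<in> ?Q"
    using subst_cong_ideal[OF Q] by blast
  moreover assume "subst ?v f = 0"
  ultimately show "\<exists>d. line a dvd f - d * line b" by simp
qed

text \<open>
  The ideal is the kernel of a homomorphism into a domain, and \<open>line c\<close> is not in it because
  that line misses the point.
\<close>

lemma line_pair_prime:
  fixes a b c :: "'k::field"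
  assumes "a \<noteq> b" "c \<noteq> a" "c \<noteq> b" "line a dvd line c * g - d * line b"
  shows "\<exists>d'. line a dvd g - d' * line b"
proof -
  have "eval (subst (cone (meet a b)) (line c)) (vector [0, 0, 1]) \<noteq> 0"
    using assms by (simp add: eval_subst_cone eval_line_meet)
  then have "subst (cone (meet a b)) (line c) \<noteq> 0"
    by auto
  moreover have "subst (cone (meet a b)) (line c * g) = 0"
    using pair_ideal_iff[OF assms(1)] assms(4) by blast
  ultimately show ?thesis
    using pair_ideal_iff[OF assms(1)] by (simp add: subst_mult)
qed

section \<open>The points where two of the lines meet\<close>

definition meeting_point :: "'k::field \<Rightarrow> 'k \<Rightarrow> ('k ^ 3) set" where
  "meeting_point a b = proj_rel `` {meet a b}"

lemma meet_nonzero: "meet a b \<noteq> 0"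
proof
  assume "meet a b = 0"
  then have "meet a b $ 3 = 0" by simp
  then show False by (simp add: meet_def vector_3)
qed

lemma meeting_point_proj_plane: "meeting_point a b \<in> proj_plane"
  unfolding meeting_point_def proj_plane_def by (rule quotientI) (simp add: meet_nonzero)

lemma meet_mem: "meet a b \<in> meeting_point a b"
  unfolding meeting_point_def
  using equiv_class_self[OF equiv_proj_rel, of "meet a b"] meet_nonzero by auto

lemma form_vanishes_at_meeting_point:
  "is_form f \<Longrightarrow> vanishes_at f (meeting_point a b) \<longleftrightarrow> eval f (meet a b) = 0"
  by (rule form_vanishes_at_iff[OF _ meeting_point_proj_plane meet_mem])

lemma vanishing_ideal_meeting_point:
  assumes "a \<noteq> b"
  shows "vanishing_ideal {meeting_point a b} \<subseteq> pair_power (line a) (line b) 1"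
  unfolding vanishing_ideal_def
proof (rule ideal.span_minimal[OF _ subspace_pair_power], clarify)
  fix f assume "is_form f" "\<forall>P\<in>{meeting_point a b}. vanishes_at f P"
  then have "subst (cone (meet a b)) f = 0"
    by (simp add: form_vanishes_at_meeting_point subst_cone_form)
  then obtain d k where "f - d * line b = line a * k"
    using pair_ideal_iff[OF assms] by (metis dvdE)
  then have "f = d * line b ^ Suc 0 + line a * k"
    by (simp add: diff_eq_eq)
  then show "f \<in> pair_power (line a) (line b) 1"
    using pair_power_SucI[of k "line a" "line b" 0 d] by simp
qed

lemma ideal_power_subset_pair_power:
  assumes "I \<subseteq> pair_power x y 1"
  shows "ideal_power I m \<subseteq> pair_power x y m"
proof (induction m)
  case (Suc m)
  have "f * g \<in> pair_power x y (Suc m)" if "f \<in> I" "g \<in> ideal_power I m" for f g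
  proof -
    have g: "g \<in> pair_power x y m" using Suc.IH that(2) by blast
    have "f \<in> pair_power x y (Suc 0)" using assms that(1) by auto
    then obtain c k where "f = c * y ^ Suc 0 + x * k"
      by (rule pair_power_SucE)
    then have "f * g = c * (y * g) + k * (x * g)"
      by (simp add: algebra_simps)
    then show ?thesis
      using snd_mult_mem[OF g] fst_mult_mem[OF g] by (simp only: pair_power_add pair_power_mult)
  qed
  then show ?case
    unfolding ideal_power.simps by (intro ideal.span_minimal subspace_pair_power) blast
qed simp

lemma line_mem_vanishing_ideal:
  assumes "c = a \<or> c = b"
  shows "line c \<in> vanishing_ideal {meeting_point a b}"
  unfolding vanishing_ideal_def
  using assms form_vanishes_at_meeting_point[OF is_form_line]
  by (intro ideal.span_base) (auto simp: is_form_line eval_line_meet)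

section \<open>Powers of point ideals meet in products of lines\<close>

lemma cancel_prod:
  fixes z :: "'b \<Rightarrow> 'a::comm_monoid_mult"
  assumes "finite B" and cancel: "\<And>k h. k \<in> B \<Longrightarrow> z k * h \<in> S \<Longrightarrow> h \<in> S"
    and "(\<Prod>k\<in>B. z k ^ n k) * h \<in> S"
  shows "h \<in> S"
  using assms
proof (induction B arbitrary: h rule: finite_induct)
  case (insert k B)
  have pow: "z k ^ i * g \<in> S \<Longrightarrow> g \<in> S" for i g
  proof (induction i)
    case (Suc i)
    have "z k * (z k ^ i * g) \<in> S"
      using Suc.prems by (simp add: mult.assoc)
    then show ?case
      using insert.prems(1) Suc.IH by blast
  qed simp
  have "z k ^ n k * ((\<Prod>k\<in>B. z k ^ n k) * h) \<in> S"
    using insert.prems(2) insert.hyps by (simp add: mult.assoc)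
  then have "(\<Prod>k\<in>B. z k ^ n k) * h \<in> S"
    by (rule pow)
  then show ?case
    using insert.IH insert.prems(1) by blast
qed simp

definition line_product :: "'k::field set \<Rightarrow> ('k \<Rightarrow> nat) \<Rightarrow> 'k plane_ring" where
  "line_product A e = (\<Prod>a\<in>A. line a ^ e a)"

definition line_products :: "'k::field set \<Rightarrow> nat \<Rightarrow> 'k plane_ring set" where
  "line_products A m = {line_product A e | e. \<forall>a\<in>A. \<forall>b\<in>A. a \<noteq> b \<longrightarrow> m \<le> e a + e b}"

lemma line_product_split:
  assumes "finite A" "a \<in> A" "b \<in> A" "a \<noteq> b"
  shows "line_product A e = line a ^ e a * (line b ^ e b * (\<Prod>k\<in>A - {a, b}. line k ^ e k))"
proof -
  have "A - {a} - {b} = A - {a, b}" by auto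
  then show ?thesis
    unfolding line_product_def
    using prod.remove[of A a "\<lambda>k. line k ^ e k"] prod.remove[of "A - {a}" b "\<lambda>k. line k ^ e k"] assms
    by simp
qed

text \<open>
  Only the factors \<open>line a\<close> and \<open>line b\<close> vanish at the point common to them.
\<close>

lemma line_product_mem_pair_power:
  assumes "finite A" "a \<in> A" "b \<in> A" "a \<noteq> b" "m \<le> e a + e b"
  shows "line_product A e \<in> pair_power (line a) (line b) m"
  unfolding line_product_split[OF assms(1-4)] mult.assoc[symmetric]
  using powers_mem pair_power_antimono[OF assms(5)] by blast

lemma span_line_products_subset_pair_power:
  assumes "finite A" "a \<in> A" "b \<in> A" "a \<noteq> b"
  shows "ideal.span (line_products A m) \<subseteq> pair_power (line a) (line b) m"
  unfolding line_products_def using assms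
  by (intro ideal.span_minimal subspace_pair_power) (auto intro: line_product_mem_pair_power)

text \<open>
  At the point common to \<open>line a\<close> and \<open>line b\<close> the product of lines vanishes to order exactly
  \<open>e a + e b\<close>. The cofactor therefore vanishes at least to the order that is still missing.
\<close>

lemma cancel_line_product:
  fixes a b :: "'k::field"
  assumes A: "finite A" "a \<in> A" "b \<in> A" and ab: "a \<noteq> b"
    and mem: "line_product A e * h \<in> pair_power (line a) (line b) m"
  shows "h \<in> pair_power (line a) (line b) (m - (e a + e b))"
proof -
  let ?Q = "pair_power (line a) (line b)" and ?P = "\<Prod>k\<in>A - {a, b}. line k ^ e k"
  have fst: "line a ^ i * g \<in> ?Q m \<Longrightarrow> g \<in> ?Q (m - i)" for i m g
  proof (induction i arbitrary: m)
    case (Suc i)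
    have "line a * (line a ^ i * g) \<in> ?Q m"
      using Suc.prems by (simp only: power_Suc mult.assoc)
    then have "line a ^ i * g \<in> ?Q (m - 1)"
      using cancel_fst line_nonzero line_prime[OF ab] by blast
    then show ?case using Suc.IH by fastforce
  qed simp
  have snd: "line b ^ i * g \<in> ?Q m \<Longrightarrow> g \<in> ?Q (m - i)" for i m g
  proof (induction i arbitrary: m)
    case (Suc i)
    have "line b * (line b ^ i * g) \<in> ?Q m"
      using Suc.prems by (simp only: power_Suc mult.assoc)
    then have "line b ^ i * g \<in> ?Q (m - 1)"
      using cancel_snd line_nonzero line_prime[OF ab] by blast
    then show ?case using Suc.IH by fastforce
  qed simp
  have "line a ^ e a * (line b ^ e b * (?P * h)) \<in> ?Q m"
    using mem unfolding line_product_split[OF A ab] by (simp only: mult.assoc)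
  then have "?P * h \<in> ?Q (m - e a - e b)"
    by (intro snd fst)
  then have "?P * h \<in> ?Q (m - (e a + e b))"
    by simp
  moreover have "g \<in> ?Q n" if "k \<in> A - {a, b}" "line k * g \<in> ?Q n" for k g n
  proof (rule cancel_third[OF line_nonzero line_prime[OF ab] _ that(2)])
    show "line a dvd line k * g - d * line b \<Longrightarrow> \<exists>d'. line a dvd g - d' * line b" for g d
      using line_pair_prime[OF ab] that(1) by auto
  qed
  ultimately show ?thesis
    using cancel_prod[of "A - {a, b}" line "?Q (m - (e a + e b))" e h] A(1) by blast
qed

text \<open>
  On \<open>line a\<close>, divisibility by powers of the other lines is a condition at distinct points, so
  that the conditions combine to divisibility by the product.
\<close>

lemma dvd_diff_prod_line_powers:
  fixes a :: "'k::field"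
  assumes "finite B" "a \<notin> B" "\<And>b. b \<in> B \<Longrightarrow> \<exists>d. line a dvd h - d * line b ^ n b"
  shows "\<exists>d. line a dvd h - d * (\<Prod>b\<in>B. line b ^ n b)"
  using assms
proof (induction B rule: finite_induct)
  case empty
  show ?case by (intro exI[of _ h]) simp
next
  case (insert b B)
  let ?P = "\<Prod>k\<in>B. line k ^ n k"
  let ?S = "{g. \<exists>d. line a dvd g - d * line b ^ n b}"
  have ab: "a \<noteq> b" using insert.prems(1) by auto
  obtain d where d: "line a dvd h - d * ?P"
    using insert.IH insert.prems by auto
  obtain e where e: "line a dvd h - e * line b ^ n b"
    using insert.prems(2) by auto
  have cancel: "g \<in> ?S" if kB: "k \<in> B" and kg: "line k * g \<in> ?S" for k g
  proof -
    have k: "k \<noteq> a" "k \<noteq> b" using insert kB by auto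
    obtain d where "line a dvd line k * g - d * line b ^ n b"
      using kg by auto
    then have "\<exists>d'. line a dvd g - d' * line b ^ n b"
    proof (rule cancel_mod_power[rotated 2])
      show "line a dvd line b * g \<Longrightarrow> line a dvd g" for g
        by (rule line_prime[OF ab])
      show "line a dvd line k * g - d * line b \<Longrightarrow> \<exists>d'. line a dvd g - d' * line b" for g d
        by (rule line_pair_prime[OF ab k])
    qed
    then show ?thesis by simp
  qed
  have "line a dvd (h - e * line b ^ n b) - (h - d * ?P)"
    using e d by (rule dvd_diff)
  then have "?P * d \<in> ?S"
    by (auto intro!: exI[of _ e] simp: mult.commute)
  then have "d \<in> ?S"
    using cancel_prod[of B line ?S n d] cancel insert.hyps(1) by blast
  then obtain d' where "line a dvd d - d' * line b ^ n b" by auto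
  then have "line a dvd (h - d * ?P) + ?P * (d - d' * line b ^ n b)"
    using d by (intro dvd_add dvd_mult)
  moreover have "(h - d * ?P) + ?P * (d - d' * line b ^ n b) = h - d' * (line b ^ n b * ?P)"
    by (simp add: algebra_simps)
  ultimately show ?case
    using insert.hyps by auto
qed

text \<open>
  The exponents of a product of lines are increased one at a time. Take \<open>a\<close> with the least
  exponent. On \<open>line a\<close> the cofactor \<open>h\<close> is divisible by the powers of the other lines that
  are missing at the points of \<open>line a\<close>. Hence the product times \<open>h\<close> is the sum of a multiple
  of a product of lines \<open>e2\<close> in which \<open>a\<close> keeps its exponent and the other exponents are
  raised, and of a multiple of the product \<open>e1\<close> in which only the exponent of \<open>a\<close> is raised.

  Minimality makes \<open>e2\<close> a generator: for \<open>b\<close> different from \<open>a\<close> its exponent is at least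
  \<open>m - e a\<close>, and two such exponents add up to at least \<open>m\<close> as \<open>2 e a < m\<close>. The second summand
  vanishes to the same orders as the whole is assumed to, and the induction applies to it.
\<close>

lemma mult_mem_span_line_products:
  fixes A :: "'k::field set"
  assumes A: "finite A"
    and "\<And>a b. a \<in> A \<Longrightarrow> b \<in> A \<Longrightarrow> a \<noteq> b \<Longrightarrow> line_product A e * h \<in> pair_power (line a) (line b) m"
  shows "line_product A e * h \<in> ideal.span (line_products A m)"
  using assms(2)
proof (induction "\<Sum>a\<in>A. m - e a" arbitrary: e h rule: less_induct)
  case less
  show ?case
  proof (cases "\<forall>a\<in>A. m \<le> 2 * e a")
    case True
    have "m \<le> e a + e b" if "a \<in> A" "b \<in> A" for a b
      using bspec[OF True that(1)] bspec[OF True that(2)] by linarith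
    then have "line_product A e \<in> line_products A m"
      unfolding line_products_def by blast
    then have "h * line_product A e \<in> ideal.span (line_products A m)"
      by (intro ideal.span_scale ideal.span_base)
    then show ?thesis by (simp only: mult.commute)
  next
    case False
    define a where "a = arg_min_on e A"
    have ne: "A \<noteq> {}" using False by auto
    have aA: "a \<in> A"
      unfolding a_def using A ne by (rule arg_min_if_finite)
    have min: "e a \<le> e b" if "b \<in> A" for b
      unfolding a_def using A ne that by (rule arg_min_least)
    have small: "2 * e a < m"
      using False min by fastforce
    define n where "n b = m - (e a + e b)" for b
    let ?B = "A - {a}"
    have "\<exists>d. line a dvd h - d * line b ^ n b" if "b \<in> ?B" for b
    proof -
      have b: "b \<in> A" "a \<noteq> b" using that by auto
      have "h \<in> pair_power (line a) (line b) (n b)"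
        unfolding n_def by (rule cancel_line_product[OF A aA b less.prems[OF aA b]])
      then show ?thesis using pair_power_imp_dvd_diff by blast
    qed
    then obtain d where "line a dvd h - d * (\<Prod>b\<in>?B. line b ^ n b)"
      using dvd_diff_prod_line_powers[of ?B a h n] A by auto
    then obtain k where "h - d * (\<Prod>b\<in>?B. line b ^ n b) = line a * k" ..
    then have h: "h = line a * k + d * (\<Prod>b\<in>?B. line b ^ n b)"
      by (simp only: diff_eq_eq)
    define e1 where "e1 = e(a := Suc (e a))"
    define e2 where "e2 b = (if b = a then e a else e b + n b)" for b
    have e: "line_product A f = line a ^ f a * (\<Prod>b\<in>?B. line b ^ f b)" for f
      unfolding line_product_def using A aA by (rule prod.remove)
    have "line_product A e1 = line a * line_product A e"
      unfolding e by (simp add: e1_def mult.assoc)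
    moreover have "line_product A e2 = line_product A e * (\<Prod>b\<in>?B. line b ^ n b)"
      unfolding e by (simp add: e2_def power_add prod.distrib mult.assoc)
    ultimately have split: "line_product A e * h = line_product A e1 * k + d * line_product A e2"
      unfolding h by (simp add: distrib_left mult_ac)
    have "m \<le> e2 b + e2 c" if "b \<in> A" "c \<in> A" "b \<noteq> c" for b c
      using min[OF that(1)] min[OF that(2)] small that(3) by (auto simp: e2_def n_def)
    then have "line_product A e2 \<in> line_products A m"
      unfolding line_products_def by blast
    then have span2: "d * line_product A e2 \<in> ideal.span (line_products A m)"
      by (intro ideal.span_scale ideal.span_base)
    have "line_product A e1 * k \<in> pair_power (line b) (line c) m"
      if bc: "b \<in> A" "c \<in> A" "b \<noteq> c" for b c
    proof -
      have "line_product A e * h - d * line_product A e2 \<in> pair_power (line b) (line c) m"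
        using span_line_products_subset_pair_power[OF A bc] span2 less.prems[OF bc]
        by (intro pair_power_diff) auto
      then show ?thesis unfolding split by simp
    qed
    moreover have "(\<Sum>b\<in>A. m - e1 b) < (\<Sum>b\<in>A. m - e b)"
      using small aA by (intro sum_strict_mono_ex1[OF A]) (auto simp: e1_def intro!: bexI[of _ a])
    ultimately have "line_product A e1 * k \<in> ideal.span (line_products A m)"
      by (intro less.hyps)
    then show ?thesis
      unfolding split using span2 by (rule ideal.span_add)
  qed
qed

lemma mem_span_line_products:
  assumes "finite A"
    and "\<And>a b. a \<in> A \<Longrightarrow> b \<in> A \<Longrightarrow> a \<noteq> b \<Longrightarrow> f \<in> pair_power (line a) (line b) m"
  shows "f \<in> ideal.span (line_products A m)"
  using mult_mem_span_line_products[of A "\<lambda>_. 0" f m] assms by (simp add: line_product_def)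

section \<open>Ordinary powers\<close>

lemma ideal_power_mult: "f \<in> ideal_power I n \<Longrightarrow> c * f \<in> ideal_power I n"
  by (cases n) (auto intro: ideal.span_scale)

lemma subspace_ideal_power: "ideal.subspace (ideal_power I n)"
  by (cases n) (auto simp: ideal.subspace_UNIV ideal.subspace_span)

lemma ideal_power_Suc_mult: "f \<in> I \<Longrightarrow> g \<in> ideal_power I n \<Longrightarrow> f * g \<in> ideal_power I (Suc n)"
  by (auto intro: ideal.span_base)

text \<open>
  A product of \<open>r\<close> factors, each of which is the product of all lines but one, has the
  exponents \<open>r - k a\<close> if \<open>line a\<close> is omitted \<open>k a\<close> times, where the \<open>k a\<close> add up to \<open>r\<close>. The
  hypothesis says that there are enough omissions to cover every exponent below \<open>r\<close>. Splitting
  off one factor, the line to omit is one whose exponent is below the required power, if there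
  is one.
\<close>

lemma line_product_mem_ideal_power:
  assumes A: "finite A" "A \<noteq> {}"
    and I: "\<And>a. a \<in> A \<Longrightarrow> (\<Prod>b\<in>A - {a}. line b) \<in> I"
    and "(\<Sum>a\<in>A. r - e a) \<le> r"
  shows "line_product A e \<in> ideal_power I r"
  using assms(4)
proof (induction r arbitrary: e)
  case (Suc r)
  have "\<exists>a\<in>A. (\<forall>b\<in>A - {a}. 0 < e b) \<and> (\<Sum>b\<in>A. r - (if b = a then e b else e b - 1)) \<le> r"
  proof (cases "\<exists>a\<in>A. e a \<le> r")
    case True
    then obtain a where a: "a \<in> A" "e a \<le> r" by auto
    have rem: "(\<Sum>b\<in>A. f b) = f a + (\<Sum>b\<in>A - {a}. f b)" for f :: "_ \<Rightarrow> nat"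
      using A(1) a(1) by (rule sum.remove)
    have le: "(Suc r - e a) + (\<Sum>b\<in>A - {a}. Suc r - e b) \<le> Suc r"
      using Suc.prems rem by simp
    \<comment> \<open>An exponent 0 elsewhere would alone use up the whole allowance \<open>Suc r\<close>, while \<open>a\<close> uses
      at least one more.\<close>
    have pos: "0 < e b" if "b \<in> A - {a}" for b
    proof (rule ccontr)
      assume "\<not> 0 < e b"
      then have "Suc r \<le> (\<Sum>b\<in>A - {a}. Suc r - e b)"
        using member_le_sum[of b "A - {a}" "\<lambda>b. Suc r - e b"] that A(1) by simp
      then show False using le a(2) by linarith
    qed
    have "r - (if b = a then e b else e b - 1) = Suc r - e b" if "b \<in> A - {a}" for b
      using pos[OF that] that by auto
    then have "(\<Sum>b\<in>A. r - (if b = a then e b else e b - 1))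
        = (r - e a) + (\<Sum>b\<in>A - {a}. Suc r - e b)"
      unfolding rem by simp
    also have "\<dots> \<le> r"
      using le a(2) by linarith
    finally show ?thesis using a(1) pos by blast
  next
    case False
    then obtain a where "a \<in> A" using A(2) by auto
    moreover have "(\<Sum>b\<in>A. r - (if b = a then e b else e b - 1)) = 0"
      using False A(1) by (auto simp: not_le intro!: sum.neutral)
    ultimately show ?thesis using False by (intro bexI[of _ a]) auto
  qed
  then obtain a where a: "a \<in> A" "\<And>b. b \<in> A - {a} \<Longrightarrow> 0 < e b"
    "(\<Sum>b\<in>A. r - (if b = a then e b else e b - 1)) \<le> r"
    by blast
  define e' where "e' b = (if b = a then e b else e b - 1)" for b
  have split: "line_product A f = line a ^ f a * (\<Prod>b\<in>A - {a}. line b ^ f b)" for f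
    unfolding line_product_def using A(1) a(1) by (rule prod.remove)
  have "(\<Prod>b\<in>A - {a}. line b ^ e b) = (\<Prod>b\<in>A - {a}. line b * line b ^ e' b)"
  proof (rule prod.cong)
    fix b assume "b \<in> A - {a}"
    then show "line b ^ e b = line b * line b ^ e' b"
      using a(2)[of b] by (cases "e b") (auto simp: e'_def)
  qed simp
  then have "line_product A e = (\<Prod>b\<in>A - {a}. line b) * line_product A e'"
    unfolding split by (simp add: e'_def prod.distrib mult.left_commute)
  moreover have "line_product A e' \<in> ideal_power I r"
    using a(3) by (intro Suc.IH) (simp add: e'_def)
  ultimately show ?case
    using ideal_power_Suc_mult I a(1) by metis
qed simp

text \<open>
  Let \<open>q\<close> be the least exponent and \<open>s\<close> the number of the others, each of which is at least
  the maximum of \<open>q\<close> and \<open>m - q\<close>. For \<open>q < r\<close> the sum is thus at most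
  \<open>(r - q) + s (r - max q (m - q))\<close> with truncated differences, which is convex in \<open>q\<close> up to
  \<open>m / 2\<close> and decreasing from there on. At \<open>q = m / 2\<close> its being at most \<open>r\<close> is the hypothesis
  on \<open>m\<close>; at \<open>q = 0\<close> it is at most \<open>r\<close>, because the hypothesis gives \<open>m \<ge> r\<close> unless \<open>s = 0\<close>.
\<close>

lemma deficiency_le:
  fixes e :: "'a \<Rightarrow> nat"
  assumes A: "finite A" "A \<noteq> {}"
    and pairs: "\<And>a b. a \<in> A \<Longrightarrow> b \<in> A \<Longrightarrow> a \<noteq> b \<Longrightarrow> m \<le> e a + e b"
    and m: "2 * r * (card A - 1) \<le> m * card A" 
  shows "(\<Sum>a\<in>A. r - e a) \<le> r"
proof -
  define a where "a = arg_min_on e A"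
  define q where "q = e a"
  define s where "s = card A - 1"
  have card: "card A = Suc s"
    using A by (simp add: s_def card_gt_0_iff)
  have aA: "a \<in> A"
    unfolding a_def using A by (rule arg_min_if_finite)
  have min: "q \<le> e b" if "b \<in> A" for b
    unfolding a_def q_def using A that by (rule arg_min_least)
  have "(\<Sum>b\<in>A. r - e b) = (r - q) + (\<Sum>b\<in>A - {a}. r - e b)"
    unfolding q_def using A(1) aA by (rule sum.remove)
  also have "(\<Sum>b\<in>A - {a}. r - e b) \<le> of_nat (card (A - {a})) * (r - max q (m - q))"
  proof (rule sum_bounded_above)
    fix b assume b: "b \<in> A - {a}"
    then have "max q (m - q) \<le> e b"
      using min[of b] pairs[OF aA, of b] by (auto simp: q_def)
    then show "r - e b \<le> r - max q (m - q)" by linarith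
  qed
  also have "of_nat (card (A - {a})) = s"
    using A(1) aA by (simp add: s_def)
  finally have sum: "(\<Sum>b\<in>A. r - e b) \<le> (r - q) + s * (r - max q (m - q))"
    by simp
  have m': "2 * r * s \<le> m * Suc s"
    using m unfolding card by simp
  have "s * (r - max q (m - q)) \<le> q" if "\<not> r \<le> q"
  proof (cases "r \<le> max q (m - q)")
    case False
    show ?thesis
    proof (cases "m - q \<le> q")
      case True
      then have "m * Suc s \<le> (2 * q) * Suc s"
        by (intro mult_right_mono) auto
      then have "2 * (r * s) \<le> 2 * (q * Suc s)"
        using m' by simp
      then have "r * s \<le> q + q * s" by simp
      then show ?thesis
        using True by (simp add: max_def right_diff_distrib' mult.commute)
    next
      case mq: False
      obtain j where j: "m = q + j" using mq by (metis nat_le_linear diff_is_0_eq' le_Suc_ex zero_le)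
      have "r * s \<le> q + j * s"
      proof (cases s)
        case (Suc s')
        have "2 * (r * s) \<le> (q + j) * Suc s"
          using m' unfolding j by (simp only: mult.assoc)
        also have "\<dots> = 2 * q + 2 * j + q * s' + j * s'"
          unfolding Suc by (simp add: algebra_simps)
        also have "\<dots> \<le> 2 * q + 2 * j + j * s' + j * s'"
          using mq j by (intro add_mono mult_right_mono order_refl) auto
        also have "\<dots> = 2 * (q + j * s)"
          unfolding Suc by (simp add: algebra_simps)
        finally have "2 * (r * s) \<le> 2 * (q + j * s)" .
        then show ?thesis by simp
      qed simp
      then show ?thesis
        using mq unfolding j by (simp add: max_def right_diff_distrib' mult.commute)
    qed
  qed simp
  then show ?thesis
    using sum by (cases "r \<le> q") (auto simp: max_def)
qed

section \<open>The resurgence of a star configuration\<close>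

definition star_points :: "'k::field set \<Rightarrow> ('k ^ 3) set set" where
  "star_points A = {meeting_point a b | a b. a \<in> A \<and> b \<in> A \<and> a \<noteq> b}"

lemma finite_star_points: "finite A \<Longrightarrow> finite (star_points A)"
  by (rule finite_subset[of _ "(\<lambda>(a, b). meeting_point a b) ` (A \<times> A)"]) (auto simp: star_points_def)

lemma star_points_subset: "star_points A \<subseteq> proj_plane"
  using meeting_point_proj_plane by (auto simp: star_points_def)

lemma symbolic_power_star:
  assumes "finite A"
  shows "symbolic_power (vanishing_ideal (star_points A)) m
    = (\<Inter>P\<in>star_points A. ideal_power (vanishing_ideal {P}) m)"
  using assms by (intro symbolic_power_vanishing_ideal finite_star_points star_points_subset)

lemma symbolic_power_star_subset:
  assumes "finite A"
  shows "symbolic_power (vanishing_ideal (star_points A)) m \<subseteq> ideal.span (line_products A m)"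
proof
  fix f assume f: "f \<in> symbolic_power (vanishing_ideal (star_points A)) m"
  show "f \<in> ideal.span (line_products A m)"
  proof (rule mem_span_line_products[OF assms])
    fix a b assume ab: "a \<in> A" "b \<in> A" "a \<noteq> b"
    then have "meeting_point a b \<in> star_points A"
      unfolding star_points_def by blast
    then have "f \<in> ideal_power (vanishing_ideal {meeting_point a b}) m"
      using f unfolding symbolic_power_star[OF assms] by blast
    then show "f \<in> pair_power (line a) (line b) m"
      using ideal_power_subset_pair_power[OF vanishing_ideal_meeting_point[OF ab(3)]] by blast
  qed
qed

lemma vanishing_ideal_star_subset:
  assumes "finite A"
  shows "vanishing_ideal (star_points A) \<subseteq> ideal.span (line_products A 1)"
proof
  fix f assume f: "f \<in> vanishing_ideal (star_points A)"
  show "f \<in> ideal.span (line_products A 1)"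
  proof (rule mem_span_line_products[OF assms])
    fix a b assume ab: "a \<in> A" "b \<in> A" "a \<noteq> b"
    have "vanishing_ideal (star_points A) \<subseteq> vanishing_ideal {meeting_point a b}"
      unfolding vanishing_ideal_def star_points_def
      by (intro ideal.span_mono) (use ab in auto)
    then show "f \<in> pair_power (line a) (line b) 1"
      using f vanishing_ideal_meeting_point[OF ab(3)] by blast
  qed
qed

lemma prod_lines_mem_vanishing_ideal:
  assumes "finite A"
  shows "(\<Prod>b\<in>A - {a}. line b) \<in> vanishing_ideal (star_points A)"
proof -
  have "eval (\<Prod>b\<in>A - {a}. line b) (meet c d) = 0" if "c \<in> A" "d \<in> A" "c \<noteq> d" for c d
    using that assms by (auto simp: eval_prod eval_line_meet)
  moreover have "is_form (\<Prod>b\<in>A - {a}. line b)"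
    by (intro is_form_prod is_form_line)
  ultimately show ?thesis
    unfolding vanishing_ideal_def star_points_def
    by (intro ideal.span_base) (auto simp: form_vanishes_at_meeting_point)
qed

text \<open>
  The generators of the symbolic power are products of lines whose exponents pairwise add up
  to at least \<open>m\<close>, and these lie in the ordinary power by counting exponents.
\<close>

lemma star_containment:
  assumes A: "finite A" "A \<noteq> {}" and m: "2 * r * (card A - 1) \<le> m * card A"
  shows "symbolic_power (vanishing_ideal (star_points A)) m \<subseteq> ideal_power (vanishing_ideal (star_points A)) r"
proof -
  have "line_products A m \<subseteq> ideal_power (vanishing_ideal (star_points A)) r"
    unfolding line_products_def
    using deficiency_le[OF A _ m]
    by (auto intro!: line_product_mem_ideal_power A prod_lines_mem_vanishing_ideal)
  then show ?thesis
    using symbolic_power_star_subset[OF A(1)] ideal.span_minimal[OF _ subspace_ideal_power] by blast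
qed

text \<open>
  The product of all lines vanishes twice at each of the points, though its degree exceeds the
  least degree of a form through the points only by one.
\<close>

lemma prod_lines_power_mem_symbolic_power:
  assumes "finite A"
  shows "(\<Prod>a\<in>A. line a) ^ k \<in> symbolic_power (vanishing_ideal (star_points A)) (2 * k)"
proof -
  have "(\<Prod>a\<in>A. line a) ^ k \<in> ideal_power (vanishing_ideal {meeting_point a b}) (2 * k)"
    if ab: "a \<in> A" "b \<in> A" "a \<noteq> b" for a b
  proof -
    let ?I = "vanishing_ideal {meeting_point a b}"
    have ab2: "line a * (line b * f) \<in> ideal_power ?I (Suc (Suc n))" if "f \<in> ideal_power ?I n" for f n
      using that by (intro ideal_power_Suc_mult line_mem_vanishing_ideal) auto
    define g where "g = (\<Prod>c\<in>A - {a, b}. line c)"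
    have "(\<Prod>c\<in>A. line c) = line a * (line b * g)"
      using line_product_split[OF assms ab, of "\<lambda>_. 1"] by (simp add: line_product_def g_def)
    then have step: "(\<Prod>c\<in>A. line c) * f = line a * (line b * (g * f))" for f
      by (simp only: mult.assoc)
    show ?thesis
    proof (induction k)
      case (Suc k)
      show ?case
        unfolding power_Suc step using ab2[OF ideal_power_mult[OF Suc.IH]] by simp
    qed simp
  qed
  then show ?thesis
    unfolding symbolic_power_star[OF assms] by (auto simp: star_points_def)
qed

text \<open>
  The lines all restrict to the variable itself, so that the power of this variable dividing
  the restriction replaces the degree as a measure of size.
\<close>

definition restrict_x :: "'k::field plane_ring \<Rightarrow> 'k plane_ring" where
  "restrict_x f = subst (vector [var 1, 0, 0]) f"

lemma restrict_x_line_product: "restrict_x (line_product A e) = var 1 ^ (\<Sum>a\<in>A. e a)"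
  by (simp add: restrict_x_def line_product_def subst_prod subst_power subst_line power_sum)

lemma power_var_dvd_imp_le:
  assumes "var i ^ n dvd (var i ^ j :: 'k::field plane_ring)"
  shows "n \<le> j"
proof (rule ccontr)
  assume "\<not> n \<le> j"
  then have n: "n = j + (n - j)" "n - j > 0" by auto
  obtain g :: "'k plane_ring" where "var i ^ j = var i ^ n * g"
    using assms by (rule dvdE)
  then have "var i ^ j * 1 = var i ^ j * (var i ^ (n - j) * g)"
    using n(1) by (metis mult.assoc mult.right_neutral power_add)
  moreover have "eval (var i) 1 = (1 :: 'k)" by simp
  then have "(var i :: 'k plane_ring) \<noteq> 0"
    by (metis eval_0 zero_neq_one)
  ultimately have "(1 :: 'k plane_ring) = var i ^ (n - j) * g"
    by simp
  then have "eval (1 :: 'k plane_ring) 0 = eval (var i ^ (n - j) * g) 0"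
    by simp
  then show False
    using n(2) by (simp add: eval_mult eval_power power_0_left split: if_splits)
qed

text \<open>
  The ideal of the points lies in the ideal generated by products of lines at most one of
  which is omitted, hence its elements have no terms of degree below \<open>card A - 1\<close>.
\<close>

lemma restrict_x_ideal_power:
  assumes A: "finite A" and f: "f \<in> ideal_power (vanishing_ideal (star_points A)) r"
  shows "var 1 ^ (r * (card A - 1)) dvd restrict_x f"
proof -
  let ?S = "\<lambda>d. {f. var 1 ^ d dvd restrict_x f}" and ?I = "vanishing_ideal (star_points A)"
  have S: "ideal.subspace (?S d)" for d
    by (auto simp: ideal.subspace_def restrict_x_def subst_add subst_mult)
  have card: "card A - 1 \<le> (\<Sum>a\<in>A. e a)"
    if e: "\<forall>a\<in>A. \<forall>b\<in>A. a \<noteq> b \<longrightarrow> 1 \<le> e a + e b" for e :: "_ \<Rightarrow> nat"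
  proof (cases "\<exists>a\<in>A. e a = 0")
    case True
    then obtain a where a: "a \<in> A" "e a = 0" by auto
    have "card A - 1 = (\<Sum>b\<in>A - {a}. 1)"
      using A a by simp
    also have "\<dots> \<le> (\<Sum>b\<in>A - {a}. e b)"
      using e a by (intro sum_mono) force
    also have "\<dots> \<le> (\<Sum>b\<in>A. e b)"
      using A by (intro sum_mono2) auto
    finally show ?thesis .
  next
    case False
    then have "(\<Sum>b\<in>A. 1) \<le> (\<Sum>b\<in>A. e b)"
      by (intro sum_mono) (auto simp: Suc_le_eq)
    then show ?thesis by simp
  qed
  have "var 1 ^ (card A - 1) dvd restrict_x (line_product A e)"
    if "\<forall>a\<in>A. \<forall>b\<in>A. a \<noteq> b \<longrightarrow> 1 \<le> e a + e b" for e
    unfolding restrict_x_line_product using card[OF that] by (rule le_imp_power_dvd)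
  then have "line_products A 1 \<subseteq> ?S (card A - 1)"
    unfolding line_products_def by blast
  then have I: "?I \<subseteq> ?S (card A - 1)"
    using vanishing_ideal_star_subset[OF A] ideal.span_minimal[OF _ S] by blast
  have "ideal_power ?I r \<subseteq> ?S (r * (card A - 1))"
  proof (induction r)
    case (Suc r)
    have "u * v \<in> ?S (Suc r * (card A - 1))" if "u \<in> ?I" "v \<in> ideal_power ?I r" for u v
    proof -
      have "var 1 ^ (card A - 1) dvd restrict_x u" "var 1 ^ (r * (card A - 1)) dvd restrict_x v"
        using I Suc.IH that by auto
      then have "var 1 ^ (card A - 1) * var 1 ^ (r * (card A - 1)) dvd restrict_x u * restrict_x v"
        by (rule mult_dvd_mono)
      then show ?thesis by (simp add: restrict_x_def subst_mult power_add)
    qed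
    then show ?case
      unfolding ideal_power.simps by (intro ideal.span_minimal S) blast
  qed simp
  then show ?thesis using f by auto
qed

lemma star_noncontainment:
  assumes "finite A" "k * card A < r * (card A - 1)"
  shows "\<not> symbolic_power (vanishing_ideal (star_points A)) (2 * k)
    \<subseteq> ideal_power (vanishing_ideal (star_points A)) r"
proof
  let ?f = "\<Prod>a\<in>A. line a"
  assume "symbolic_power (vanishing_ideal (star_points A)) (2 * k)
    \<subseteq> ideal_power (vanishing_ideal (star_points A)) r"
  then have "?f ^ k \<in> ideal_power (vanishing_ideal (star_points A)) r"
    using prod_lines_power_mem_symbolic_power[OF assms(1)] by blast
  then have "var 1 ^ (r * (card A - 1)) dvd restrict_x (?f ^ k)"
    by (rule restrict_x_ideal_power[OF assms(1)])
  moreover have "?f ^ k = line_product A (\<lambda>_. k)"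
    by (simp add: line_product_def prod_power_distrib)
  ultimately have "var 1 ^ (r * (card A - 1)) dvd (var 1 ^ (k * card A) :: 'a plane_ring)"
    by (simp add: restrict_x_line_product mult.commute)
  then show False
    using power_var_dvd_imp_le assms(2) by fastforce
qed

lemma resurgence_star_le:
  assumes A: "finite A" "A \<noteq> {}"
  shows "resurgence (vanishing_ideal (star_points A)) \<le> ereal (2 - 2 / card A)"
  unfolding resurgence_def
proof (rule Sup_least)
  fix \<rho>
  assume "\<rho> \<in> {ereal (real m / real r) | m r. m > 0 \<and> r > 0 \<and>
    \<not> symbolic_power (vanishing_ideal (star_points A)) m \<subseteq> ideal_power (vanishing_ideal (star_points A)) r}"
  then obtain m r where \<rho>: "\<rho> = ereal (real m / real r)" and r: "r > 0"
    and "\<not> symbolic_power (vanishing_ideal (star_points A)) m \<subseteq> ideal_power (vanishing_ideal (star_points A)) r"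
    by blast
  then have "m * card A < 2 * r * (card A - 1)"
    using star_containment[OF A] not_le by blast
  then have "real (m * card A) \<le> real (2 * r * (card A - 1))"
    by (simp only: of_nat_le_iff less_imp_le)
  moreover have c: "card A > 0" using A by (simp add: card_gt_0_iff)
  ultimately have "real m * real (card A) \<le> 2 * real r * (real (card A) - 1)"
    by (simp add: of_nat_diff Suc_le_eq)
  then have "real m / real r \<le> 2 * (real (card A) - 1) / real (card A)"
    using r c by (simp add: field_simps)
  also have "\<dots> = 2 - 2 / card A"
    using c by (simp add: field_simps)
  finally show "\<rho> \<le> ereal (2 - 2 / card A)"
    unfolding \<rho> by simp
qed

text \<open>
  The number \<open>s\<close> of lines satisfies \<open>s (s - 2) < (s - 1)\<^sup>2\<close>, so that the power \<open>s - 2\<close> of the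
  product of all lines has too small a degree to lie in the power \<open>s - 1\<close> of the ideal.
\<close>

lemma resurgence_star_ge:
  assumes A: "finite A" "3 \<le> card A"
  shows "ereal (2 - 2 / (card A - 1)) \<le> resurgence (vanishing_ideal (star_points A))"
proof -
  obtain t where t: "card A = t + 3" using A(2) by (metis add.commute le_Suc_ex)
  have "(t + 1) * card A < (t + 2) * (card A - 1)"
    by (simp add: t algebra_simps)
  then have "\<not> symbolic_power (vanishing_ideal (star_points A)) (2 * (t + 1))
    \<subseteq> ideal_power (vanishing_ideal (star_points A)) (t + 2)"
    by (rule star_noncontainment[OF A(1)])
  then have "ereal (real (2 * (t + 1)) / real (t + 2)) \<le> resurgence (vanishing_ideal (star_points A))"
    unfolding resurgence_def
    by (intro Sup_upper CollectI exI[of _ "2 * (t + 1)"] exI[of _ "t + 2"]) auto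
  moreover have "real (2 * (t + 1)) / real (t + 2) = 2 - 2 / (card A - 1)"
    by (simp add: t field_simps)
  ultimately show ?thesis by simp
qed

text \<open>
  Over a finite field, adding 1 to the product of all \<open>x - a\<close> gives a polynomial without
  roots.
\<close>

lemma infinite_alg_closed: "infinite (UNIV :: 'k::alg_closed_field set)"
proof
  assume fin: "finite (UNIV :: 'k set)"
  define p :: "'k poly" where "p = (\<Prod>a\<in>UNIV. [:- a, 1:]) + 1"
  have "poly (\<Prod>a\<in>UNIV. [:- a, 1:]) x = 0" for x :: 'k
    using fin by (auto simp: poly_prod)
  then have "poly p x = 1" for x by (simp add: p_def)
  moreover have "degree (\<Prod>a\<in>(UNIV :: 'k set). [:- a, 1:]) = card (UNIV :: 'k set)"
    by (subst degree_prod_eq_sum_degree) auto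
  then have "degree p > 0"
    unfolding p_def using fin by (subst degree_add_eq_left) (auto simp: card_gt_0_iff)
  then obtain x where "poly p x = 0"
    using alg_closed_imp_poly_has_root by blast
  ultimately show False
    by simp
qed

theorem corollary5p1:
  fixes \<epsilon> :: real
  assumes "0 < \<epsilon>" and "\<epsilon> < 1 / 2"
  shows "\<exists>I :: 'k::alg_closed_field plane_ring set.
    radical_ideal_of_points I \<and> ereal (2 - \<epsilon>) \<le> resurgence I \<and> resurgence I < 2"
proof -
  obtain n :: nat where n: "2 / \<epsilon> < n"
    using reals_Archimedean2 by blast
  obtain A :: "'k set" where A: "finite A" "card A = n + 3"
    using infinite_arbitrarily_large[OF infinite_alg_closed] by blast
  let ?I = "vanishing_ideal (star_points A)"
  have ne: "A \<noteq> {}" using A by auto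
  have "2 / real (card A - 1) \<le> \<epsilon>"
    using n assms(1) A(2) by (simp add: field_simps)
  then have "ereal (2 - \<epsilon>) \<le> ereal (2 - 2 / real (card A - 1))" by simp
  also have "\<dots> \<le> resurgence ?I"
    using resurgence_star_ge[of A] A by simp
  finally have lower: "ereal (2 - \<epsilon>) \<le> resurgence ?I" .
  have "resurgence ?I \<le> ereal (2 - 2 / card A)"
    by (rule resurgence_star_le[OF A(1) ne])
  also have "\<dots> < 2"
    using A by simp
  finally have upper: "resurgence ?I < 2" .
  have "\<not> is_singleton A" "A \<noteq> {}"
    using A by (auto simp: is_singleton_altdef)
  then obtain a b where "a \<in> A" "b \<in> A" "a \<noteq> b"
    by (metis all_not_in_conv is_singletonI')
  then have "star_points A \<noteq> {}"
    by (auto simp: star_points_def)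
  then have "radical_ideal_of_points ?I"
    unfolding radical_ideal_of_points_def
    using finite_star_points[OF A(1)] star_points_subset by blast
  then show ?thesis using lower upper by blast
qed

end
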